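(* The category $\mathbf{Cstab}_{\mathsf m}$ (measurable complete cones and measurable stable functions $f$ from $P$ to $Q$ with $f(\mathcal B P)\subseteq\mathcal B Q$) is cartesian: for a finite family $(P_i)_{i\in I}$, the product $\prod_{i\in I}P_i$ with the set-theoretic projections $\pi_i$ and tupling $y\mapsto(f_i(y))_{i\in I}$ is a categorical product; the terminal object is the cone $\{0\}$ whose measurability tests are all $0$.
   Context: Cones: $\mathbb R_{\ge0}$-semimodules $P$ with $\|\cdot\|_P$ satisfying cancellation ($x+y=x+y'\Rightarrow y=y'$), $\|\alpha x\|=\alpha\|x\|$, $\|x\|=0\Rightarrow x=0$, $\|x+x'\|\le\|x\|+\|x'\|$, $\|x\|\le\|x+x'\|$; unit ball $\mathcal BP$; order $x\le x'$ iff $x'=x+y$; complete if non-decreasing sequences in $\mathcal BP$ have lubs in $\mathcal BP$. $f:\mathcal BP\to Q$ is pre-stable if for all $n\ge1$, $\vec u\in P^n$ and $x$ with $x+\sum u_i\in\mathcal BP$, $\sum_{I\subseteq\{1..n\},\,n-|I|\text{ odd}}f(x+\sum_{i\in I}u_i)\le\sum_{I,\,n-|I|\text{ even}}f(x+\sum_{i\in I}u_i)$; stable if moreover bounded, non-decreasing and preserving lubs of non-decreasing sequences in $\mathcal BP$. Measurable cone: sets $\mathcal M_n(P)$ of maps from $\mathbb R^n$ to linear Scott-continuous functionals $P\to\mathbb R_{\ge0}$, containing $0$, closed under precomposition with measurable $h:\mathbb R^p\to\mathbb R^n$, with $\vec r\mapsto l(\vec r)(x)$ measurable. Measurable path of arity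 $n$: $\gamma:\mathbb R^n\to P$ with bounded image such that $(\vec r,\vec s)\mapsto l(\vec r)(\gamma(\vec s))$ is measurable for every test $l\in\mathcal M_k(P)$. A stable $f$ is measurable if it maps measurable paths with values in $\mathcal BP$ to measurable paths. Product $\prod_{i\in I}P_i$ ($I$ finite): tuples with componentwise operations, norm $\sup_i\|x_i\|_{P_i}$, tests $\mathcal M_n=\{\bigoplus_il_i: l_i\in\mathcal M_n(P_i)\}$ with $(\bigoplus_il_i)(\vec r)((x_i)_i)=\sum_il_i(\vec r)(x_i)$. *)

theory Defs
  imports "HOL-Algebra.Module" "HOL-Analysis.Analysis"
begin

section \<open>Cones\<close>

text \<open>The additive structure and the scalar multiplication are the fields of the
  HOL-Algebra record \<open>module\<close>.  Its fields \<open>mult\<close> and \<open>one\<close> play no role here.  Scalars are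
  non-negative reals, so every law about a scalar is guarded by \<open>0 \<le> a\<close>.\<close>

record 'a pos_cone = "(real, 'a) module" +
  cnorm :: "'a \<Rightarrow> real"

definition unit_ball :: "('a, 'm) pos_cone_scheme \<Rightarrow> 'a set" where
  "unit_ball P = {x \<in> carrier P. cnorm P x \<le> 1}"

definition cone_le :: "('a, 'm) pos_cone_scheme \<Rightarrow> 'a \<Rightarrow> 'a \<Rightarrow> bool" where
  "cone_le P x x' \<longleftrightarrow>
     x \<in> carrier P \<and> x' \<in> carrier P \<and> (\<exists>y\<in>carrier P. x' = x \<oplus>\<^bsub>P\<^esub> y)"

definition cone_lub :: "('a, 'm) pos_cone_scheme \<Rightarrow> (nat \<Rightarrow> 'a) \<Rightarrow> 'a \<Rightarrow> bool" where
  "cone_lub P x s \<longleftrightarrow>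
     (\<forall>n. cone_le P (x n) s) \<and> (\<forall>t. (\<forall>n. cone_le P (x n) t) \<longrightarrow> cone_le P s t)"

locale pos_cone = abelian_monoid P for P :: "('a, 'm) pos_cone_scheme" (structure) +
  assumes smult_closed: "\<lbrakk>0 \<le> a; x \<in> carrier P\<rbrakk> \<Longrightarrow> a \<odot> x \<in> carrier P"
    and smult_l_distr: "\<lbrakk>0 \<le> a; 0 \<le> b; x \<in> carrier P\<rbrakk> \<Longrightarrow> (a + b) \<odot> x = a \<odot> x \<oplus> b \<odot> x"
    and smult_r_distr: "\<lbrakk>0 \<le> a; x \<in> carrier P; y \<in> carrier P\<rbrakk> \<Longrightarrow> a \<odot> (x \<oplus> y) = a \<odot> x \<oplus> a \<odot> y"
    and smult_assoc: "\<lbrakk>0 \<le> a; 0 \<le> b; x \<in> carrier P\<rbrakk> \<Longrightarrow> (a * b) \<odot> x = a \<odot> (b \<odot> x)"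
    and smult_one: "x \<in> carrier P \<Longrightarrow> 1 \<odot> x = x"
    and smult_zero_left: "x \<in> carrier P \<Longrightarrow> 0 \<odot> x = \<zero>"
    and smult_zero_right: "0 \<le> a \<Longrightarrow> a \<odot> \<zero> = \<zero>"
    and cancellation:
      "\<lbrakk>x \<in> carrier P; y \<in> carrier P; y' \<in> carrier P; x \<oplus> y = x \<oplus> y'\<rbrakk> \<Longrightarrow> y = y'"
    and cnorm_nonneg: "x \<in> carrier P \<Longrightarrow> 0 \<le> cnorm P x"
    and cnorm_smult: "\<lbrakk>0 \<le> a; x \<in> carrier P\<rbrakk> \<Longrightarrow> cnorm P (a \<odot> x) = a * cnorm P x"
    and cnorm_eq_zero: "\<lbrakk>x \<in> carrier P; cnorm P x = 0\<rbrakk> \<Longrightarrow> x = \<zero>"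
    and cnorm_triangle:
      "\<lbrakk>x \<in> carrier P; x' \<in> carrier P\<rbrakk> \<Longrightarrow> cnorm P (x \<oplus> x') \<le> cnorm P x + cnorm P x'"
    and cnorm_mono: "\<lbrakk>x \<in> carrier P; x' \<in> carrier P\<rbrakk> \<Longrightarrow> cnorm P x \<le> cnorm P (x \<oplus> x')"

text \<open>The least upper bound is taken in the whole cone, and it must lie in the unit ball.\<close>

locale complete_cone = pos_cone +
  assumes complete:
    "\<lbrakk>\<And>n. x n \<in> unit_ball P; monotone (\<le>) (cone_le P) x\<rbrakk>
       \<Longrightarrow> \<exists>s\<in>unit_ball P. cone_lub P x s"

definition preserves_lubs ::
    "('a, 'm) pos_cone_scheme \<Rightarrow> ('b, 'n) pos_cone_scheme \<Rightarrow> ('a \<Rightarrow> 'b) \<Rightarrow> bool" where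
  "preserves_lubs P Q f \<longleftrightarrow>
     (\<forall>x s. (\<forall>n. x n \<in> unit_ball P) \<and> monotone (\<le>) (cone_le P) x \<and>
            s \<in> unit_ball P \<and> cone_lub P x s
        \<longrightarrow> cone_lub Q (\<lambda>n. f (x n)) (f s))"


section \<open>Pre-stable and stable functions\<close>

definition pre_stable ::
    "('a, 'm) pos_cone_scheme \<Rightarrow> ('b, 'n) pos_cone_scheme \<Rightarrow> ('a \<Rightarrow> 'b) \<Rightarrow> bool" where
  "pre_stable P Q f \<longleftrightarrow>
     f \<in> unit_ball P \<rightarrow> carrier Q \<and>
     (\<forall>n\<ge>1. \<forall>u\<in>{1..n} \<rightarrow> carrier P. \<forall>x\<in>carrier P.
        x \<oplus>\<^bsub>P\<^esub> (\<Oplus>\<^bsub>P\<^esub>i\<in>{1..n}. u i) \<in> unit_ball P \<longrightarrow>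
        cone_le Q
          (\<Oplus>\<^bsub>Q\<^esub>I\<in>{I. I \<subseteq> {1..n} \<and> odd (n - card I)}. f (x \<oplus>\<^bsub>P\<^esub> (\<Oplus>\<^bsub>P\<^esub>i\<in>I. u i)))
          (\<Oplus>\<^bsub>Q\<^esub>I\<in>{I. I \<subseteq> {1..n} \<and> even (n - card I)}. f (x \<oplus>\<^bsub>P\<^esub> (\<Oplus>\<^bsub>P\<^esub>i\<in>I. u i))))"

definition stable ::
    "('a, 'm) pos_cone_scheme \<Rightarrow> ('b, 'n) pos_cone_scheme \<Rightarrow> ('a \<Rightarrow> 'b) \<Rightarrow> bool" where
  "stable P Q f \<longleftrightarrow>
     pre_stable P Q f \<and>
     (\<exists>B. \<forall>x\<in>unit_ball P. cnorm Q (f x) \<le> B) \<and>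
     monotone_on (unit_ball P) (cone_le P) (cone_le Q) f \<and>
     preserves_lubs P Q f"


section \<open>Measurable cones and measurable paths\<close>

text \<open>\<open>\<real>\<^sup>n\<close> with its Borel sigma-algebra; vectors are extensional functions on \<open>{..<n}\<close>.\<close>

abbreviation Rn :: "nat \<Rightarrow> (nat \<Rightarrow> real) measure" where
  "Rn n \<equiv> Pi\<^sub>M {..<n} (\<lambda>_. borel)"

definition nonneg_real_cone :: "real pos_cone" where
  "nonneg_real_cone =
     \<lparr>carrier = {0..}, monoid.mult = (*), one = 1, zero = 0, add = (+), module.smult = (*), cnorm = (\<lambda>r. r)\<rparr>"

text \<open>The linear Scott-continuous functionals, as extensional functions on the carrier.\<close>

definition dual_cone :: "('a, 'm) pos_cone_scheme \<Rightarrow> ('a \<Rightarrow> real) set" where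
  "dual_cone P =
     {\<phi> \<in> carrier P \<rightarrow>\<^sub>E {0..}.
        (\<forall>x\<in>carrier P. \<forall>y\<in>carrier P. \<phi> (x \<oplus>\<^bsub>P\<^esub> y) = \<phi> x + \<phi> y) \<and>
        (\<forall>a\<ge>0. \<forall>x\<in>carrier P. \<phi> (a \<odot>\<^bsub>P\<^esub> x) = a * \<phi> x) \<and>
        preserves_lubs P nonneg_real_cone \<phi>}"

record 'a mcone = "'a pos_cone" +
  mtests :: "nat \<Rightarrow> ((nat \<Rightarrow> real) \<Rightarrow> 'a \<Rightarrow> real) set"

locale measurable_cone = pos_cone P for P :: "('a, 'm) mcone_scheme" (structure) +
  assumes mtests_dual: "mtests P n \<subseteq> space (Rn n) \<rightarrow>\<^sub>E dual_cone P"
    and mtests_zero: "(\<lambda>r\<in>space (Rn n). \<lambda>x\<in>carrier P. 0) \<in> mtests P n"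
    and mtests_precompose:
      "\<lbrakk>l \<in> mtests P n; h \<in> Rn p \<rightarrow>\<^sub>M Rn n\<rbrakk> \<Longrightarrow> (\<lambda>r\<in>space (Rn p). l (h r)) \<in> mtests P p"
    and mtests_measurable:
      "\<lbrakk>l \<in> mtests P n; x \<in> carrier P\<rbrakk> \<Longrightarrow> (\<lambda>r. l r x) \<in> borel_measurable (Rn n)"

locale measurable_complete_cone = measurable_cone + complete_cone

text \<open>\<open>\<real>\<^sup>k\<^sup>+\<^sup>n\<close> is rendered as the product of \<open>\<real>\<^sup>k\<close> and \<open>\<real>\<^sup>n\<close>.\<close>

definition measurable_path ::
    "('a, 'm) mcone_scheme \<Rightarrow> nat \<Rightarrow> ((nat \<Rightarrow> real) \<Rightarrow> 'a) \<Rightarrow> bool" where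
  "measurable_path P n \<gamma> \<longleftrightarrow>
     \<gamma> \<in> space (Rn n) \<rightarrow> carrier P \<and>
     (\<exists>B. \<forall>s\<in>space (Rn n). cnorm P (\<gamma> s) \<le> B) \<and>
     (\<forall>k. \<forall>l\<in>mtests P k. (\<lambda>(r, s). l r (\<gamma> s)) \<in> borel_measurable (Rn k \<Otimes>\<^sub>M Rn n))"

definition measurable_stable ::
    "('a, 'm) mcone_scheme \<Rightarrow> ('b, 'n) mcone_scheme \<Rightarrow> ('a \<Rightarrow> 'b) \<Rightarrow> bool" where
  "measurable_stable P Q f \<longleftrightarrow>
     stable P Q f \<and>
     (\<forall>n \<gamma>. measurable_path P n \<gamma> \<and> \<gamma> \<in> space (Rn n) \<rightarrow> unit_ball P
        \<longrightarrow> measurable_path Q n (\<lambda>s. f (\<gamma> s)))"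


section \<open>The category of measurable complete cones and measurable stable functions\<close>

text \<open>The objects are the measurable complete cones.  Carriers may live in different types, so the
  hom-sets are defined polymorphically.  Morphisms are extensional functions on the unit ball of
  the domain, so that equality of morphisms is equality in HOL.\<close>

definition cstab_hom ::
    "('a, 'm) mcone_scheme \<Rightarrow> ('b, 'n) mcone_scheme \<Rightarrow> ('a \<Rightarrow> 'b) set" where
  "cstab_hom P Q = {f \<in> unit_ball P \<rightarrow>\<^sub>E unit_ball Q. measurable_stable P Q f}"

definition cstab_id :: "('a, 'm) mcone_scheme \<Rightarrow> 'a \<Rightarrow> 'a" where
  "cstab_id P = (\<lambda>x\<in>unit_ball P. x)"

definition cstab_comp ::
    "('a, 'm) mcone_scheme \<Rightarrow> ('b \<Rightarrow> 'c) \<Rightarrow> ('a \<Rightarrow> 'b) \<Rightarrow> 'a \<Rightarrow> 'c" where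
  "cstab_comp P g f = compose (unit_ball P) g f"

text \<open>The norm is the supremum in the non-negative reals; inserting \<open>0\<close> makes it \<open>0\<close> for the
  empty family and changes nothing otherwise.\<close>

definition prod_cone :: "'i set \<Rightarrow> ('i \<Rightarrow> 'a mcone) \<Rightarrow> ('i \<Rightarrow> 'a) mcone" where
  "prod_cone I P =
     \<lparr>carrier = (\<Pi>\<^sub>E i\<in>I. carrier (P i)),
      monoid.mult = undefined,
      one = undefined,
      zero = (\<lambda>i\<in>I. \<zero>\<^bsub>P i\<^esub>),
      add = (\<lambda>x y. \<lambda>i\<in>I. x i \<oplus>\<^bsub>P i\<^esub> y i),
      module.smult = (\<lambda>a x. \<lambda>i\<in>I. a \<odot>\<^bsub>P i\<^esub> x i),
      cnorm = (\<lambda>x. Sup (insert 0 ((\<lambda>i. cnorm (P i) (x i)) ` I))),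
      mtests = (\<lambda>n. {\<lambda>r\<in>space (Rn n). \<lambda>x\<in>(\<Pi>\<^sub>E i\<in>I. carrier (P i)). \<Sum>i\<in>I. l i r (x i) |l.
                      \<forall>i\<in>I. l i \<in> mtests (P i) n})\<rparr>"

definition cstab_proj :: "'i set \<Rightarrow> ('i \<Rightarrow> 'a mcone) \<Rightarrow> 'i \<Rightarrow> ('i \<Rightarrow> 'a) \<Rightarrow> 'a" where
  "cstab_proj I P i = (\<lambda>x\<in>unit_ball (prod_cone I P). x i)"

definition cstab_tuple ::
    "'i set \<Rightarrow> ('b, 'n) mcone_scheme \<Rightarrow> ('i \<Rightarrow> 'b \<Rightarrow> 'a) \<Rightarrow> 'b \<Rightarrow> 'i \<Rightarrow> 'a" where
  "cstab_tuple I Y f = (\<lambda>y\<in>unit_ball Y. \<lambda>i\<in>I. f i y)"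

definition zero_cone :: "unit mcone" where
  "zero_cone =
     \<lparr>carrier = {()}, monoid.mult = undefined, one = undefined, zero = (), add = (\<lambda>_ _. ()),
      module.smult = (\<lambda>_ _. ()), cnorm = (\<lambda>_. 0),
      mtests = (\<lambda>n. {\<lambda>r\<in>space (Rn n). \<lambda>x\<in>{()}. 0})\<rparr>"

end

theory Submission imports Defs begin

text \<open>The point that needs an argument is that pre-stable functions compose.  For a pre-stable \<open>f\<close>,
  Moebius inversion on the subsets of \<open>{1..n}\<close> gives \<open>f (x + \<Sum>i\<in>I. u i) = (\<Sum>J \<subseteq> I. m J)\<close> where the
  iterated differences \<open>m J\<close> lie in the target cone, and conversely such a representation implies
  pre-stability.  Applied to \<open>g\<close> at \<open>0\<close> with the increments \<open>m J\<close>, indexed by sets \<open>J\<close>, the same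
  fact gives \<open>g (\<Sum>J\<in>S. m J) = (\<Sum>T \<subseteq> S. M T)\<close>.  Taking \<open>S = Pow I\<close> and grouping the families \<open>T\<close>
  by their union \<open>K\<close> represents \<open>g \<circ> f\<close> by the coefficients \<open>N K = (\<Sum>T | \<Union>T = K. M T)\<close>.\<close>

section \<open>Moebius inversion in cones\<close>

text \<open>The defining inequality is not visibly inherited by composites: along increments
  \<open>u i\<close>, a pre-stable \<open>f\<close> has mixed differences of every order, so its
  values over the subsets \<open>I\<close> are in general not sums over \<open>I\<close> of fixed
  increments, and the inequality for \<open>g\<close> does not apply to them directly. The
  representation removes this obstacle: every mixed difference is promoted to an increment of its
  own. The value at the base point is the difference of order zero and is promoted as well, which is
  why \<open>g\<close> can be expanded at zero. Two circumstances shape the details. A cone has no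
  subtraction, so an alternating sum is kept as a pair of sums, one for each sign, and every
  identity is an equation between sums; where an inverse would be used, cancellation takes its
  place. Moreover the increments for \<open>g\<close> are indexed by sets, while the definition
  numbers them from 1 to \<open>n\<close>, so pre-stability is first transported to arbitrary finite
  index sets.\<close>

definition parity_Pow :: "bool \<Rightarrow> 'k set \<Rightarrow> 'k set set" where
  "parity_Pow b A = {I. I \<subseteq> A \<and> even (card A - card I) = b}"

lemma parity_Pow_subset: "parity_Pow b A \<subseteq> Pow A"
  by (auto simp: parity_Pow_def)

lemma parity_Pow_empty [simp]: "parity_Pow True {} = {{}}" "parity_Pow False {} = {}"
  by (auto simp: parity_Pow_def)

lemma finite_parity_Pow: "finite A \<Longrightarrow> finite (parity_Pow b A)"
  by (rule finite_subset[OF parity_Pow_subset]) auto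

text \<open>The Boolean is the sign: \<open>True\<close> for plus, when the complement of
  \<open>I\<close> has even size. Putting \<open>a\<close> into \<open>I\<close> keeps the
  complement in \<open>A\<close>; leaving \<open>a\<close> out enlarges the complement by one and
  flips the sign. This is the recursion of iterated differences, a shifted difference minus the
  unshifted one.\<close>

lemma parity_Pow_insert:
  assumes "finite A" "a \<notin> A"
  shows "parity_Pow b (insert a A) = insert a ` parity_Pow b A \<union> parity_Pow (\<not> b) A"
proof -
  have card: "card (insert a I) = Suc (card I)" "card I \<le> card A" if "I \<subseteq> A" for I
    using that assms by (auto simp: card_mono finite_subset intro!: card_insert_disjoint)
  have "I \<in> insert a ` parity_Pow b A \<union> parity_Pow (\<not> b) A" if I: "I \<in> parity_Pow b (insert a A)" for I
  proof (cases "a \<in> I")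
    case True
    then obtain I' where I': "I = insert a I'" "a \<notin> I'" by (meson mk_disjoint_insert)
    then have "I' \<subseteq> A" using I by (auto simp: parity_Pow_def)
    then show ?thesis using I I' card[OF \<open>I' \<subseteq> A\<close>] assms by (auto simp: parity_Pow_def)
  next
    case False
    then have "I \<subseteq> A" using I by (auto simp: parity_Pow_def)
    then show ?thesis using I card[OF \<open>I \<subseteq> A\<close>] assms by (auto simp: parity_Pow_def Suc_diff_le)
  qed
  moreover have "insert a I \<in> parity_Pow b (insert a A)" if "I \<in> parity_Pow b A" for I
    using that card[of I] assms by (auto simp: parity_Pow_def)
  moreover have "I \<in> parity_Pow b (insert a A)" if "I \<in> parity_Pow (\<not> b) A" for I
    using that card[of I] assms by (auto simp: parity_Pow_def Suc_diff_le)
  ultimately show ?thesis by blast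
qed

lemma parity_Pow_True_remove:
  assumes "finite A"
  shows "parity_Pow True A = insert A (parity_Pow True A - {A})" "A \<notin> parity_Pow False A"
  using assms by (auto simp: parity_Pow_def)

context pos_cone
begin

lemma right_cancellation:
  assumes "x \<in> carrier P" "y \<in> carrier P" "y' \<in> carrier P" "y \<oplus> x = y' \<oplus> x"
  shows "y = y'"
  using assms cancellation[of x y y'] by (simp add: a_comm)

lemma finsum_parity_Pow_insert:
  assumes "finite A" "a \<notin> A" "F \<in> Pow (insert a A) \<rightarrow> carrier P"
  shows "(\<Oplus>I\<in>parity_Pow b (insert a A). F I)
       = (\<Oplus>I\<in>parity_Pow b A. F (insert a I)) \<oplus> (\<Oplus>I\<in>parity_Pow (\<not> b) A. F I)"
proof -
  have sub: "I \<subseteq> A" if "I \<in> parity_Pow c A" for I c using that by (auto simp: parity_Pow_def)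
  have inj: "inj_on (insert a) (parity_Pow b A)"
    using assms(2) by (auto simp: inj_on_def parity_Pow_def)
  have "(\<Oplus>I\<in>parity_Pow b (insert a A). F I)
      = (\<Oplus>I\<in>insert a ` parity_Pow b A. F I) \<oplus> (\<Oplus>I\<in>parity_Pow (\<not> b) A. F I)"
    unfolding parity_Pow_insert[OF assms(1,2)]
    using assms(2,3) by (intro finsum_Un_disjoint) (auto simp: finite_parity_Pow assms(1) dest!: sub)
  also have "(\<Oplus>I\<in>insert a ` parity_Pow b A. F I) = (\<Oplus>I\<in>parity_Pow b A. F (insert a I))"
    using assms(3) by (intro finsum_reindex inj) (auto dest!: sub)
  finally show ?thesis .
qed

lemma finsum_Pow_insert:
  assumes "finite A" "a \<notin> A" "m \<in> Pow (insert a A) \<rightarrow> carrier P"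
  shows "(\<Oplus>J\<in>Pow (insert a A). m J)
       = (\<Oplus>J\<in>Pow A. m J) \<oplus> (\<Oplus>J\<in>Pow A. m (insert a J))"
proof -
  have inj: "inj_on (insert a) (Pow A)"
    using assms(2) by (auto simp: inj_on_def)
  have "(\<Oplus>J\<in>Pow (insert a A). m J) = (\<Oplus>J\<in>Pow A. m J) \<oplus> (\<Oplus>J\<in>insert a ` Pow A. m J)"
    unfolding Pow_insert using assms by (intro finsum_Un_disjoint) auto
  also have "(\<Oplus>J\<in>insert a ` Pow A. m J) = (\<Oplus>J\<in>Pow A. m (insert a J))"
    using assms(3) by (intro finsum_reindex inj) auto
  finally show ?thesis .
qed

text \<open>In an alternating sum of subset sums every coefficient occurs equally often with both
  signs, except the top one. In the induction, the subset sum over \<open>insert a I\<close> splits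
  into \<open>?F I\<close> and \<open>?F' I\<close>. The \<open>?F\<close> terms then occur over
  both parities on either side, and what remains is the claim for \<open>A\<close> with the
  coefficients of the sets containing \<open>a\<close>. Only rearrangement is involved, no
  cancellation.\<close>

lemma finsum_parity_Pow_moebius:
  assumes "finite A" "m \<in> Pow A \<rightarrow> carrier P"
  shows "(\<Oplus>I\<in>parity_Pow True A. \<Oplus>J\<in>Pow I. m J) = (\<Oplus>I\<in>parity_Pow False A. \<Oplus>J\<in>Pow I. m J) \<oplus> m A"
  using assms
proof (induction A arbitrary: m rule: finite_induct)
  case empty
  then show ?case by simp
next
  case (insert a A)
  let ?F = "\<lambda>I. \<Oplus>J\<in>Pow I. m J" and ?F' = "\<lambda>I. \<Oplus>J\<in>Pow I. m (insert a J)"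
  have sub: "I \<subseteq> A" if "I \<in> parity_Pow c A" for I c using that by (auto simp: parity_Pow_def)
  have cl: "?F I \<in> carrier P" if "I \<subseteq> insert a A" for I
    using insert.prems that by (intro finsum_closed) auto
  have cl': "?F' I \<in> carrier P" if "I \<subseteq> A" for I
    using insert.prems that by (intro finsum_closed) auto
  have parF: "?F \<in> parity_Pow b A \<rightarrow> carrier P" "?F' \<in> parity_Pow b A \<rightarrow> carrier P" for b
    using cl cl' by (simp_all add: Pi_iff parity_Pow_def subset_insertI2)
  have F: "?F (insert a I) = ?F I \<oplus> ?F' I" if "I \<subseteq> A" for I
    using that insert.hyps insert.prems
    by (intro finsum_Pow_insert) (auto intro: finite_subset)
  have E: "(\<Oplus>I\<in>parity_Pow b A. ?F (insert a I)) = (\<Oplus>I\<in>parity_Pow b A. ?F I) \<oplus> (\<Oplus>I\<in>parity_Pow b A. ?F' I)" for b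
  proof -
    have "(\<Oplus>I\<in>parity_Pow b A. ?F (insert a I)) = (\<Oplus>I\<in>parity_Pow b A. ?F I \<oplus> ?F' I)"
    proof (intro finsum_cong' F funcsetI refl)
      fix I assume "I \<in> parity_Pow b A"
      then have "I \<subseteq> A" by (rule sub)
      then show "I \<subseteq> A" "?F I \<oplus> ?F' I \<in> carrier P"
        using cl[of I] cl'[of I] by auto
    qed
    also have "\<dots> = (\<Oplus>I\<in>parity_Pow b A. ?F I) \<oplus> (\<Oplus>I\<in>parity_Pow b A. ?F' I)"
      using parF by (rule finsum_addf)
    finally show ?thesis .
  qed
  have S: "(\<Oplus>I\<in>parity_Pow b A. ?F I) \<in> carrier P" "(\<Oplus>I\<in>parity_Pow b A. ?F' I) \<in> carrier P" for b
    using parF by (auto intro!: finsum_closed)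
  have m: "m (insert a A) \<in> carrier P" using insert.prems by auto
  \<comment> \<open>The induction hypothesis is taken for the shifted coefficients
    \<open>m (insert a J)\<close>, whose top one is \<open>m (insert a A)\<close>; hence the
    generalization over \<open>m\<close>.\<close>
  have IH: "(\<Oplus>I\<in>parity_Pow True A. ?F' I) = (\<Oplus>I\<in>parity_Pow False A. ?F' I) \<oplus> m (insert a A)"
    using insert.prems by (intro insert.IH) auto
  have "(\<Oplus>I\<in>parity_Pow b (insert a A). ?F I)
      = (\<Oplus>I\<in>parity_Pow b A. ?F I) \<oplus> (\<Oplus>I\<in>parity_Pow b A. ?F' I) \<oplus> (\<Oplus>I\<in>parity_Pow (\<not> b) A. ?F I)" for b
    using cl insert.hyps by (subst finsum_parity_Pow_insert) (auto simp: E)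
  then show ?case using S m by (simp add: IH a_ac)
qed

text \<open>The equations \<open>E\<close> say that \<open>m J\<close> is the alternating difference
  of \<open>F\<close> over \<open>J\<close>. The subset sums of \<open>m\<close> satisfy the same
  equations by the previous lemma, and such equations determine \<open>F\<close> recursively: each
  involves one new value, \<open>F J\<close>, beside values at proper subsets. Cancelling the latter
  is where the cancellation law of cones enters.\<close>

lemma moebius_inversion:
  assumes "finite A" "F \<in> Pow A \<rightarrow> carrier P" "m \<in> Pow A \<rightarrow> carrier P"
    and E: "\<And>J. J \<subseteq> A \<Longrightarrow> (\<Oplus>I\<in>parity_Pow True J. F I) = (\<Oplus>I\<in>parity_Pow False J. F I) \<oplus> m J"
    and "I \<subseteq> A"
  shows "F I = (\<Oplus>J\<in>Pow I. m J)"
proof -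
  have "finite I" using assms(1,5) by (rule rev_finite_subset)
  then show ?thesis using \<open>I \<subseteq> A\<close>
  proof (induction I rule: finite_psubset_induct)
    case (psubset I)
    let ?G = "\<lambda>I. \<Oplus>J\<in>Pow I. m J"
    have cl: "F K \<in> carrier P" "?G K \<in> carrier P" if "K \<subseteq> I" for K
    proof -
      have "K \<subseteq> A" using that psubset.prems by auto
      then show "F K \<in> carrier P" "?G K \<in> carrier P"
        using assms(2,3) by (auto intro!: finsum_closed simp: Pi_iff)
    qed
    have sub: "K \<subseteq> I" if "K \<in> parity_Pow c I" for K c using that by (auto simp: parity_Pow_def)
    have mI: "m \<in> Pow I \<rightarrow> carrier P" using assms(3) psubset.prems by auto
    have IH: "F K = ?G K" if "K \<subset> I" for K
      using psubset.IH[OF that] that psubset.prems by auto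
    \<comment> \<open>\<open>I\<close> itself always carries the plus sign, so the minus half runs
      over proper subsets only and the induction hypothesis rewrites all of it. In the plus half the
      term at \<open>I\<close> is first split off.\<close>
    have O: "(\<Oplus>K\<in>parity_Pow False I. F K) = (\<Oplus>K\<in>parity_Pow False I. ?G K)"
      using cl parity_Pow_True_remove(2)[OF psubset.hyps]
      by (intro finsum_cong' IH) (auto dest: sub)
    have T: "(\<Oplus>K\<in>parity_Pow True I - {I}. F K) = (\<Oplus>K\<in>parity_Pow True I - {I}. ?G K)"
      using cl by (intro finsum_cong' IH) (auto dest: sub)
    have T1: "(\<Oplus>K\<in>parity_Pow True I. H K) = H I \<oplus> (\<Oplus>K\<in>parity_Pow True I - {I}. H K)"
      if "\<And>K. K \<subseteq> I \<Longrightarrow> H K \<in> carrier P" for H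
    proof -
      have "(\<Oplus>K\<in>insert I (parity_Pow True I - {I}). H K) = H I \<oplus> (\<Oplus>K\<in>parity_Pow True I - {I}. H K)"
        using that psubset.hyps by (intro finsum_insert) (auto simp: finite_parity_Pow dest: sub)
      then show ?thesis using parity_Pow_True_remove(1)[OF psubset.hyps] by simp
    qed
    have "(\<Oplus>K\<in>parity_Pow True I. F K) = (\<Oplus>K\<in>parity_Pow True I. ?G K)"
      unfolding E[OF psubset.prems] O finsum_parity_Pow_moebius[OF psubset.hyps mI] ..
    then have "F I \<oplus> (\<Oplus>K\<in>parity_Pow True I - {I}. ?G K) = ?G I \<oplus> (\<Oplus>K\<in>parity_Pow True I - {I}. ?G K)"
      using T1[of F] T1[of ?G] cl T by simp
    then show ?case
    proof (rule right_cancellation[rotated -1])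
      show "F I \<in> carrier P" "?G I \<in> carrier P" by (rule cl, simp)+
      have "?G \<in> parity_Pow True I - {I} \<rightarrow> carrier P" using cl(2) by (simp add: Pi_iff parity_Pow_def)
      then show "(\<Oplus>K\<in>parity_Pow True I - {I}. ?G K) \<in> carrier P" by (rule finsum_closed)
    qed
  qed
qed

lemma ball_downward:
  assumes "x \<in> carrier P" "y \<in> carrier P" "x \<oplus> y \<in> unit_ball P"
  shows "x \<in> unit_ball P"
  using cnorm_mono[OF assms(1,2)] assms by (auto simp: unit_ball_def)

lemma finsum_split:
  assumes "finite A" "I \<subseteq> A" "u \<in> A \<rightarrow> carrier P"
  shows "(\<Oplus>i\<in>A. u i) = (\<Oplus>i\<in>I. u i) \<oplus> (\<Oplus>i\<in>A - I. u i)"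
proof -
  have "(\<Oplus>i\<in>I \<union> (A - I). u i) = (\<Oplus>i\<in>I. u i) \<oplus> (\<Oplus>i\<in>A - I. u i)"
    using assms by (intro finsum_Un_disjoint) (auto intro: finite_subset)
  moreover have "I \<union> (A - I) = A" using assms by auto
  ultimately show ?thesis by simp
qed

text \<open>Pre-stability only assumes that the full sum lies in the ball. Since the norm is
  monotone, every partial sum is then a legitimate argument as well.\<close>

lemma partial_sum_in_ball:
  assumes "finite A" "u \<in> A \<rightarrow> carrier P" "x \<in> carrier P"
    and "x \<oplus> (\<Oplus>i\<in>A. u i) \<in> unit_ball P" "I \<subseteq> A"
  shows "x \<oplus> (\<Oplus>i\<in>I. u i) \<in> unit_ball P"
proof (rule ball_downward)
  have c: "(\<Oplus>i\<in>I. u i) \<in> carrier P" "(\<Oplus>i\<in>A - I. u i) \<in> carrier P"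
    using assms(2,5) by (auto intro!: finsum_closed)
  show "x \<oplus> (\<Oplus>i\<in>I. u i) \<in> carrier P" "(\<Oplus>i\<in>A - I. u i) \<in> carrier P"
    using c assms(3) by auto
  show "x \<oplus> (\<Oplus>i\<in>I. u i) \<oplus> (\<Oplus>i\<in>A - I. u i) \<in> unit_ball P"
    using assms(4) finsum_split[OF assms(1,5,2)] c assms(3) by (simp add: a_assoc)
qed

lemma finsum_reindex_bij:
  assumes "bij_betw h A B" "f \<in> B \<rightarrow> carrier P"
  shows "(\<Oplus>y\<in>B. f y) = (\<Oplus>x\<in>A. f (h x))"
  using assms finsum_reindex[of f h A] by (auto simp: bij_betw_def)

end

section \<open>Pre-stability as a representation by coefficients\<close>

lemma card_image_bij: "bij_betw h A B \<Longrightarrow> I \<subseteq> A \<Longrightarrow> card (h ` I) = card I"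
  by (meson bij_betw_def card_image inj_on_subset)

lemma bij_betw_parity_Pow:
  assumes "bij_betw h A B"
  shows "bij_betw (image h) (parity_Pow b A) (parity_Pow b B)"
proof -
  have card: "card (h ` I) = card I" if "I \<subseteq> A" for I
    using that by (rule card_image_bij[OF assms])
  have Pow: "bij_betw (image h) (Pow A) (Pow B)"
    using assms by (rule bij_betw_Pow)
  have "image h ` parity_Pow b A = parity_Pow b B"
  proof (intro equalityI subsetI)
    fix J assume J: "J \<in> parity_Pow b B"
    then have "J \<in> image h ` Pow A"
      using Pow by (auto simp: parity_Pow_def bij_betw_def)
    then obtain I where "I \<subseteq> A" "J = h ` I" by auto
    with J card[of I] bij_betw_same_card[OF assms] show "J \<in> image h ` parity_Pow b A"
      by (auto simp: parity_Pow_def)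
  next
    fix J assume "J \<in> image h ` parity_Pow b A"
    then show "J \<in> parity_Pow b B"
      using card bij_betw_same_card[OF assms] assms by (auto simp: parity_Pow_def bij_betw_def)
  qed
  with Pow show ?thesis
    using inj_on_subset[OF _ parity_Pow_subset] by (auto simp: bij_betw_def)
qed

text \<open>Pulling the increments back along a bijection of \<open>{1..card A}\<close> with
  \<open>A\<close> changes neither the sums of increments nor the sizes of the index sets, hence not
  the signs. The set \<open>A\<close> must be inhabited because the definition starts at
  \<open>n = 1\<close>. In composites \<open>A\<close> is replaced by a powerset.\<close>

lemma pre_stable_index_set:
  assumes "pos_cone P" "pos_cone Q" and f: "pre_stable P Q f"
    and "finite A" "A \<noteq> {}" and u: "u \<in> A \<rightarrow> carrier P" and x: "x \<in> carrier P"
    and ball: "x \<oplus>\<^bsub>P\<^esub> (\<Oplus>\<^bsub>P\<^esub>i\<in>A. u i) \<in> unit_ball P"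
  shows "cone_le Q (\<Oplus>\<^bsub>Q\<^esub>I\<in>parity_Pow False A. f (x \<oplus>\<^bsub>P\<^esub> (\<Oplus>\<^bsub>P\<^esub>i\<in>I. u i)))
                   (\<Oplus>\<^bsub>Q\<^esub>I\<in>parity_Pow True A. f (x \<oplus>\<^bsub>P\<^esub> (\<Oplus>\<^bsub>P\<^esub>i\<in>I. u i)))"
proof -
  interpret P: pos_cone P by fact
  interpret Q: pos_cone Q by fact
  obtain h where h: "bij_betw h {1..card A} A"
    using ex_bij_betw_nat_finite_1[OF \<open>finite A\<close>] by auto
  let ?u = "\<lambda>k. u (h k)" and ?F = "\<lambda>I. f (x \<oplus>\<^bsub>P\<^esub> (\<Oplus>\<^bsub>P\<^esub>i\<in>I. u i))"
  have fc: "f \<in> unit_ball P \<rightarrow> carrier Q" using f by (simp add: pre_stable_def)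
  have hI: "bij_betw h I (h ` I)" "h ` I \<subseteq> A" if "I \<subseteq> {1..card A}" for I
    using that h by (auto simp: bij_betw_def inj_on_subset)
  have F: "?F I \<in> carrier Q" if "I \<subseteq> A" for I
    using P.partial_sum_in_ball[OF \<open>finite A\<close> u x ball that] fc by auto
  have Fh: "?F (h ` I) = f (x \<oplus>\<^bsub>P\<^esub> (\<Oplus>\<^bsub>P\<^esub>i\<in>I. ?u i))" if "I \<subseteq> {1..card A}" for I
  proof -
    have "u \<in> h ` I \<rightarrow> carrier P" using u hI[OF that] by auto
    then show ?thesis by (simp only: P.finsum_reindex_bij[OF hI(1)[OF that]])
  qed
  have S: "(\<Oplus>\<^bsub>Q\<^esub>I\<in>parity_Pow b A. ?F I)
      = (\<Oplus>\<^bsub>Q\<^esub>I\<in>parity_Pow b {1..card A}. f (x \<oplus>\<^bsub>P\<^esub> (\<Oplus>\<^bsub>P\<^esub>i\<in>I. ?u i)))" for b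
  proof -
    have "(\<Oplus>\<^bsub>Q\<^esub>I\<in>parity_Pow b A. ?F I) = (\<Oplus>\<^bsub>Q\<^esub>I\<in>parity_Pow b {1..card A}. ?F (h ` I))"
      using F by (intro Q.finsum_reindex_bij bij_betw_parity_Pow h) (auto simp: parity_Pow_def)
    also have "\<dots> = (\<Oplus>\<^bsub>Q\<^esub>I\<in>parity_Pow b {1..card A}. f (x \<oplus>\<^bsub>P\<^esub> (\<Oplus>\<^bsub>P\<^esub>i\<in>I. ?u i)))"
    proof (intro Q.finsum_cong' Fh funcsetI)
      fix I assume "I \<in> parity_Pow b {1..card A}"
      then have I: "I \<subseteq> {1..card A}" by (simp add: parity_Pow_def)
      then show "f (x \<oplus>\<^bsub>P\<^esub> (\<Oplus>\<^bsub>P\<^esub>i\<in>I. ?u i)) \<in> carrier Q"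
        using F[OF hI(2)[OF I]] Fh[OF I] by simp
    qed (auto simp: parity_Pow_def)
    finally show ?thesis .
  qed
  have "card A \<ge> 1" using assms(4,5) by (simp add: Suc_le_eq card_gt_0_iff)
  moreover have "?u \<in> {1..card A} \<rightarrow> carrier P" using u h by (auto simp: bij_betw_def)
  moreover have "x \<oplus>\<^bsub>P\<^esub> (\<Oplus>\<^bsub>P\<^esub>i\<in>{1..card A}. ?u i) \<in> unit_ball P"
    using ball u by (simp only: P.finsum_reindex_bij[OF h])
  ultimately have "cone_le Q
      (\<Oplus>\<^bsub>Q\<^esub>I\<in>parity_Pow False {1..card A}. f (x \<oplus>\<^bsub>P\<^esub> (\<Oplus>\<^bsub>P\<^esub>i\<in>I. ?u i)))
      (\<Oplus>\<^bsub>Q\<^esub>I\<in>parity_Pow True {1..card A}. f (x \<oplus>\<^bsub>P\<^esub> (\<Oplus>\<^bsub>P\<^esub>i\<in>I. ?u i)))"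
    using f x unfolding pre_stable_def parity_Pow_def by simp
  then show ?thesis by (simp only: S)
qed

text \<open>The coefficient \<open>m J\<close> is the iterated difference of \<open>f\<close> at
  \<open>x\<close> in the directions \<open>u j\<close> for \<open>j\<close> in \<open>J\<close>.
  Pre-stability along \<open>J\<close> says precisely that this difference exists in the cone, and
  inversion then recovers the values of \<open>f\<close>.\<close>

lemma pre_stable_moebius:
  assumes "pos_cone P" "pos_cone Q" and f: "pre_stable P Q f"
    and A: "finite A" and u: "u \<in> A \<rightarrow> carrier P" and x: "x \<in> carrier P"
    and ball: "x \<oplus>\<^bsub>P\<^esub> (\<Oplus>\<^bsub>P\<^esub>i\<in>A. u i) \<in> unit_ball P"
  shows "\<exists>m\<in>Pow A \<rightarrow> carrier Q. \<forall>I\<subseteq>A.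
    f (x \<oplus>\<^bsub>P\<^esub> (\<Oplus>\<^bsub>P\<^esub>i\<in>I. u i)) = (\<Oplus>\<^bsub>Q\<^esub>J\<in>Pow I. m J)"
proof -
  interpret P: pos_cone P by fact
  interpret Q: pos_cone Q by fact
  let ?F = "\<lambda>I. f (x \<oplus>\<^bsub>P\<^esub> (\<Oplus>\<^bsub>P\<^esub>i\<in>I. u i))"
  have fc: "f \<in> unit_ball P \<rightarrow> carrier Q" using f by (simp add: pre_stable_def)
  have in_ball: "x \<oplus>\<^bsub>P\<^esub> (\<Oplus>\<^bsub>P\<^esub>i\<in>I. u i) \<in> unit_ball P" if "I \<subseteq> A" for I
    by (rule P.partial_sum_in_ball[OF A u x ball that])
  then have F: "?F \<in> Pow A \<rightarrow> carrier Q" using fc by auto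
  have "\<exists>y\<in>carrier Q. (\<Oplus>\<^bsub>Q\<^esub>I\<in>parity_Pow True J. ?F I) = (\<Oplus>\<^bsub>Q\<^esub>I\<in>parity_Pow False J. ?F I) \<oplus>\<^bsub>Q\<^esub> y"
    if "J \<subseteq> A" for J
  proof (cases "J = {}")
    \<comment> \<open>The definition gives no information for zero increments; here the minus sum is
      empty and the difference is the value of \<open>f\<close> at the base point.\<close>
    case True
    have "?F {} \<in> carrier Q" using F by (rule funcset_mem) simp
    with True show ?thesis by auto
  next
    case False
    have "u \<in> J \<rightarrow> carrier P" "finite J"
      using u that A by (auto intro: finite_subset)
    from pre_stable_index_set[OF assms(1-3) \<open>finite J\<close> False this(1) x in_ball[OF that]]
    show ?thesis by (auto simp: cone_le_def)
  qed
  then obtain m where m: "\<And>J. J \<subseteq> A \<Longrightarrow> m J \<in> carrier Q"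
    "\<And>J. J \<subseteq> A \<Longrightarrow> (\<Oplus>\<^bsub>Q\<^esub>I\<in>parity_Pow True J. ?F I) = (\<Oplus>\<^bsub>Q\<^esub>I\<in>parity_Pow False J. ?F I) \<oplus>\<^bsub>Q\<^esub> m J"
    by metis
  have mc: "m \<in> Pow A \<rightarrow> carrier Q" using m(1) by auto
  then have "?F I = (\<Oplus>\<^bsub>Q\<^esub>J\<in>Pow I. m J)" if "I \<subseteq> A" for I
    using A F m(2) that by (intro Q.moebius_inversion[where A = A])
  with mc show ?thesis by blast
qed

text \<open>The plus sum exceeds the minus sum by exactly the top coefficient
  \<open>m {1..n}\<close>, which belongs to the cone and so witnesses the inequality.\<close>

lemma pre_stableI:
  assumes "pos_cone P" "pos_cone Q" and fc: "f \<in> unit_ball P \<rightarrow> carrier Q"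
    and ex: "\<And>A u x. finite (A :: nat set) \<Longrightarrow> u \<in> A \<rightarrow> carrier P \<Longrightarrow> x \<in> carrier P
      \<Longrightarrow> x \<oplus>\<^bsub>P\<^esub> (\<Oplus>\<^bsub>P\<^esub>i\<in>A. u i) \<in> unit_ball P
      \<Longrightarrow> \<exists>m\<in>Pow A \<rightarrow> carrier Q. \<forall>I\<subseteq>A.
            f (x \<oplus>\<^bsub>P\<^esub> (\<Oplus>\<^bsub>P\<^esub>i\<in>I. u i)) = (\<Oplus>\<^bsub>Q\<^esub>J\<in>Pow I. m J)"
  shows "pre_stable P Q f"
  unfolding pre_stable_def
proof (intro conjI fc allI impI ballI)
  interpret P: pos_cone P by fact
  interpret Q: pos_cone Q by fact
  fix n :: nat and u x
  assume u: "u \<in> {1..n} \<rightarrow> carrier P" and x: "x \<in> carrier P"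
    and ball: "x \<oplus>\<^bsub>P\<^esub> (\<Oplus>\<^bsub>P\<^esub>i\<in>{1..n}. u i) \<in> unit_ball P"
  let ?F = "\<lambda>I. f (x \<oplus>\<^bsub>P\<^esub> (\<Oplus>\<^bsub>P\<^esub>i\<in>I. u i))"
  from ex[OF _ u x ball] obtain m where m: "m \<in> Pow {1..n} \<rightarrow> carrier Q"
    "\<And>I. I \<subseteq> {1..n} \<Longrightarrow> ?F I = (\<Oplus>\<^bsub>Q\<^esub>J\<in>Pow I. m J)" by blast
  have F: "?F I \<in> carrier Q" if "I \<subseteq> {1..n}" for I
    using P.partial_sum_in_ball[OF _ u x ball that] fc by auto
  have S: "(\<Oplus>\<^bsub>Q\<^esub>I\<in>parity_Pow b {1..n}. ?F I) = (\<Oplus>\<^bsub>Q\<^esub>I\<in>parity_Pow b {1..n}. \<Oplus>\<^bsub>Q\<^esub>J\<in>Pow I. m J)" for b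
    using F m(2) by (intro Q.finsum_cong') (auto simp: parity_Pow_def)
  have "(\<Oplus>\<^bsub>Q\<^esub>I\<in>parity_Pow True {1..n}. ?F I) = (\<Oplus>\<^bsub>Q\<^esub>I\<in>parity_Pow False {1..n}. ?F I) \<oplus>\<^bsub>Q\<^esub> m {1..n}"
    unfolding S by (rule Q.finsum_parity_Pow_moebius[OF _ m(1)]) simp
  moreover have "(\<Oplus>\<^bsub>Q\<^esub>I\<in>parity_Pow b {1..n}. ?F I) \<in> carrier Q" for b
    using F by (intro Q.finsum_closed) (auto simp: parity_Pow_def)
  ultimately have "cone_le Q (\<Oplus>\<^bsub>Q\<^esub>I\<in>parity_Pow False {1..n}. ?F I) (\<Oplus>\<^bsub>Q\<^esub>I\<in>parity_Pow True {1..n}. ?F I)"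
    using m(1) by (auto simp: cone_le_def)
  then show "cone_le Q (\<Oplus>\<^bsub>Q\<^esub>I\<in>{I. I \<subseteq> {1..n} \<and> odd (n - card I)}. ?F I)
                       (\<Oplus>\<^bsub>Q\<^esub>I\<in>{I. I \<subseteq> {1..n} \<and> even (n - card I)}. ?F I)"
    by (simp add: parity_Pow_def)
qed

text \<open>The composite is given as any \<open>k\<close> that agrees with it on the ball. This
  covers restricted functions and also lets the lemma serve as a congruence rule.\<close>

lemma pre_stable_comp:
  assumes "pos_cone P" "pos_cone Q" "pos_cone R"
    and f: "pre_stable P Q f" and g: "pre_stable Q R g"
    and fb: "f \<in> unit_ball P \<rightarrow> unit_ball Q"
    and k: "\<And>x. x \<in> unit_ball P \<Longrightarrow> k x = g (f x)"
  shows "pre_stable P R k"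
proof (rule pre_stableI[OF assms(1,3)])
  interpret P: pos_cone P by fact
  interpret Q: pos_cone Q by fact
  interpret R: pos_cone R by fact
  show "k \<in> unit_ball P \<rightarrow> carrier R"
    using fb g k by (auto simp: pre_stable_def Pi_iff)
  fix A :: "nat set" and u x
  assume A: "finite A" and u: "u \<in> A \<rightarrow> carrier P" and x: "x \<in> carrier P"
    and ball: "x \<oplus>\<^bsub>P\<^esub> (\<Oplus>\<^bsub>P\<^esub>i\<in>A. u i) \<in> unit_ball P"
  have in_ball: "x \<oplus>\<^bsub>P\<^esub> (\<Oplus>\<^bsub>P\<^esub>i\<in>I. u i) \<in> unit_ball P" if "I \<subseteq> A" for I
    by (rule P.partial_sum_in_ball[OF _ u x ball that]) (rule A)
  obtain m where m: "m \<in> Pow A \<rightarrow> carrier Q"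
    "\<And>I. I \<subseteq> A \<Longrightarrow> f (x \<oplus>\<^bsub>P\<^esub> (\<Oplus>\<^bsub>P\<^esub>i\<in>I. u i)) = (\<Oplus>\<^bsub>Q\<^esub>J\<in>Pow I. m J)"
    using pre_stable_moebius[OF assms(1,2) f A u x ball] by blast
  have sum0: "\<zero>\<^bsub>Q\<^esub> \<oplus>\<^bsub>Q\<^esub> (\<Oplus>\<^bsub>Q\<^esub>J\<in>S. m J) = (\<Oplus>\<^bsub>Q\<^esub>J\<in>S. m J)" if "S \<subseteq> Pow A" for S
    using m(1) that by (intro Q.l_zero Q.finsum_closed) auto
  \<comment> \<open>The base point for \<open>g\<close> is zero, since \<open>f x\<close> is already
    counted among the increments as \<open>m {}\<close>. The sum of all increments is the value of
    \<open>f\<close> at the full sum, and \<open>f\<close> maps the ball into the ball.\<close>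
  have ball0: "\<zero>\<^bsub>Q\<^esub> \<oplus>\<^bsub>Q\<^esub> (\<Oplus>\<^bsub>Q\<^esub>J\<in>Pow A. m J) \<in> unit_ball Q"
    using fb in_ball[OF subset_refl] m(2)[OF subset_refl] sum0[OF subset_refl] by (auto simp: Pi_iff)
  obtain M where M: "M \<in> Pow (Pow A) \<rightarrow> carrier R"
    "\<And>S. S \<subseteq> Pow A \<Longrightarrow> g (\<zero>\<^bsub>Q\<^esub> \<oplus>\<^bsub>Q\<^esub> (\<Oplus>\<^bsub>Q\<^esub>J\<in>S. m J)) = (\<Oplus>\<^bsub>R\<^esub>T\<in>Pow S. M T)"
    using pre_stable_moebius[OF assms(2,3) g _ m(1) Q.zero_closed ball0] A by blast
  \<comment> \<open>The index set contains only families of subsets of \<open>K\<close>, so it is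
    finite for finite \<open>K\<close>. It does not mention \<open>I\<close>: one choice of
    coefficients has to serve all \<open>I\<close> inside \<open>A\<close> simultaneously.\<close>
  define N where "N K = (\<Oplus>\<^bsub>R\<^esub>T\<in>{T. \<Union>T = K}. M T)" for K
  show "\<exists>m\<in>Pow A \<rightarrow> carrier R. \<forall>I\<subseteq>A.
          k (x \<oplus>\<^bsub>P\<^esub> (\<Oplus>\<^bsub>P\<^esub>i\<in>I. u i)) = (\<Oplus>\<^bsub>R\<^esub>J\<in>Pow I. m J)"
  proof (intro bexI[of _ N] allI impI funcsetI)
    have M': "M T \<in> carrier R" if "\<Union>T \<subseteq> A" for T
      using M(1) that by (auto simp: Pi_iff)
    show "N K \<in> carrier R" if "K \<in> Pow A" for K
      unfolding N_def using that by (intro R.finsum_closed) (auto intro!: M')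
    fix I assume I: "I \<subseteq> A"
    then have fin: "finite I" by (rule finite_subset) (rule A)
    have "k (x \<oplus>\<^bsub>P\<^esub> (\<Oplus>\<^bsub>P\<^esub>i\<in>I. u i)) = (\<Oplus>\<^bsub>R\<^esub>T\<in>Pow (Pow I). M T)"
      using I M(2)[of "Pow I"] sum0[of "Pow I"] m(2)[OF I] k[OF in_ball[OF I]] by auto
    \<comment> \<open>A family consists of subsets of \<open>I\<close> iff its union is a subset of
      \<open>I\<close>, so the fibres of the union map partition \<open>Pow (Pow I)\<close>.\<close>
    also have "Pow (Pow I) = (\<Union>K\<in>Pow I. {T. \<Union>T = K})" by auto
    also have "(\<Oplus>\<^bsub>R\<^esub>T\<in>(\<Union>K\<in>Pow I. {T. \<Union>T = K}). M T) = (\<Oplus>\<^bsub>R\<^esub>K\<in>Pow I. N K)"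
      unfolding N_def
    proof (rule R.add.finprod_UN_disjoint)
      show "finite {T. \<Union>T = K}" if "K \<in> Pow I" for K
        using that fin by (auto intro: finite_subset[of _ "Pow (Pow I)"])
      show "M T \<in> carrier R" if "K \<in> Pow I" "T \<in> {T. \<Union>T = K}" for K T
        using that I by (intro M') auto
    qed (use fin in \<open>auto simp: pairwise_def disjnt_def\<close>)
    finally show "k (x \<oplus>\<^bsub>P\<^esub> (\<Oplus>\<^bsub>P\<^esub>i\<in>I. u i)) = (\<Oplus>\<^bsub>R\<^esub>J\<in>Pow I. N J)" .
  qed
qed

text \<open>An additive map has no differences of order two or more: the coefficients are its value
  at the base point, its values at the single increments, and zero. Identities and projections are
  covered by this case.\<close>

lemma pre_stable_additive:
  assumes "pos_cone P" "pos_cone Q"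
    and fc: "\<And>x. x \<in> carrier P \<Longrightarrow> f x \<in> carrier Q"
    and f0: "f \<zero>\<^bsub>P\<^esub> = \<zero>\<^bsub>Q\<^esub>"
    and add: "\<And>x y. x \<in> carrier P \<Longrightarrow> y \<in> carrier P \<Longrightarrow> f (x \<oplus>\<^bsub>P\<^esub> y) = f x \<oplus>\<^bsub>Q\<^esub> f y"
    and k: "\<And>x. x \<in> unit_ball P \<Longrightarrow> k x = f x"
  shows "pre_stable P Q k"
proof (rule pre_stableI[OF assms(1,2)])
  interpret P: pos_cone P by fact
  interpret Q: pos_cone Q by fact
  show "k \<in> unit_ball P \<rightarrow> carrier Q" using fc k by (auto simp: unit_ball_def)
  fix A :: "nat set" and u x
  assume A: "finite A" and u: "u \<in> A \<rightarrow> carrier P" and x: "x \<in> carrier P"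
    and ball: "x \<oplus>\<^bsub>P\<^esub> (\<Oplus>\<^bsub>P\<^esub>i\<in>A. u i) \<in> unit_ball P"
  define m where "m J = (if J = {} then f x else if card J = 1 then f (u (the_elem J)) else \<zero>\<^bsub>Q\<^esub>)" for J
  have fu: "f (u i) \<in> carrier Q" if "i \<in> A" for i using u fc that by auto
  have fsum: "f (\<Oplus>\<^bsub>P\<^esub>i\<in>I. u i) = (\<Oplus>\<^bsub>Q\<^esub>i\<in>I. f (u i))" if "I \<subseteq> A" for I
  proof -
    have "finite I" using that by (rule finite_subset) (rule A)
    then show ?thesis using that
    proof (induction I)
      case (insert a I)
      have "u \<in> I \<rightarrow> carrier P" "u a \<in> carrier P" using insert.prems u by auto
      moreover have "(\<lambda>i. f (u i)) \<in> I \<rightarrow> carrier Q" "f (u a) \<in> carrier Q"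
        using insert.prems fu by auto
      ultimately show ?case using insert by (simp add: add)
    qed (simp add: f0)
  qed
  have mc: "m \<in> Pow A \<rightarrow> carrier Q"
    using fc x fu by (auto simp: m_def card_1_singleton_iff)
  show "\<exists>m\<in>Pow A \<rightarrow> carrier Q. \<forall>I\<subseteq>A.
          k (x \<oplus>\<^bsub>P\<^esub> (\<Oplus>\<^bsub>P\<^esub>i\<in>I. u i)) = (\<Oplus>\<^bsub>Q\<^esub>J\<in>Pow I. m J)"
  proof (intro bexI[OF _ mc] allI impI)
    fix I assume I: "I \<subseteq> A"
    then have fin: "finite I" by (rule finite_subset) (rule A)
    have "(\<Oplus>\<^bsub>Q\<^esub>J\<in>Pow I. m J) = (\<Oplus>\<^bsub>Q\<^esub>J\<in>insert {} ((\<lambda>i. {i}) ` I). m J)"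
    proof (rule Q.add.finprod_mono_neutral_cong_right)
      show "m J = \<zero>\<^bsub>Q\<^esub>" if "J \<in> Pow I - insert {} ((\<lambda>i. {i}) ` I)" for J
        using that by (auto simp: m_def card_1_singleton_iff)
    qed (use fin I mc in auto)
    also have "\<dots> = m {} \<oplus>\<^bsub>Q\<^esub> (\<Oplus>\<^bsub>Q\<^esub>J\<in>(\<lambda>i. {i}) ` I. m J)"
      using fin I mc by (intro Q.finsum_insert) auto
    also have "(\<Oplus>\<^bsub>Q\<^esub>J\<in>(\<lambda>i. {i}) ` I. m J) = (\<Oplus>\<^bsub>Q\<^esub>i\<in>I. m {i})"
      using I mc by (intro Q.finsum_reindex) auto
    also have "\<dots> = (\<Oplus>\<^bsub>Q\<^esub>i\<in>I. f (u i))" by (simp add: m_def)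
    also have "\<dots> = f (\<Oplus>\<^bsub>P\<^esub>i\<in>I. u i)" using fsum[OF I] by simp
    also have "m {} \<oplus>\<^bsub>Q\<^esub> f (\<Oplus>\<^bsub>P\<^esub>i\<in>I. u i) = f (x \<oplus>\<^bsub>P\<^esub> (\<Oplus>\<^bsub>P\<^esub>i\<in>I. u i))"
      using I u x by (subst add) (auto simp: m_def intro!: P.finsum_closed)
    also have "\<dots> = k (x \<oplus>\<^bsub>P\<^esub> (\<Oplus>\<^bsub>P\<^esub>i\<in>I. u i))"
      by (intro k[symmetric] P.partial_sum_in_ball[OF A u x ball I])
    finally show "k (x \<oplus>\<^bsub>P\<^esub> (\<Oplus>\<^bsub>P\<^esub>i\<in>I. u i)) = (\<Oplus>\<^bsub>Q\<^esub>J\<in>Pow I. m J)" by simp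
  qed
qed

section \<open>Morphisms\<close>

text \<open>Boundedness is not asked for separately: values in the unit ball of \<open>Q\<close> are
  bounded by 1.\<close>

lemma cstab_homI:
  assumes "f \<in> unit_ball P \<rightarrow>\<^sub>E unit_ball Q" "pre_stable P Q f"
    and "monotone_on (unit_ball P) (cone_le P) (cone_le Q) f" "preserves_lubs P Q f"
    and "\<And>n \<gamma>. measurable_path P n \<gamma> \<Longrightarrow> \<gamma> \<in> space (Rn n) \<rightarrow> unit_ball P
           \<Longrightarrow> measurable_path Q n (\<lambda>s. f (\<gamma> s))"
  shows "f \<in> cstab_hom P Q"
proof -
  have "\<forall>x\<in>unit_ball P. cnorm Q (f x) \<le> 1"
    using assms(1) by (auto simp: unit_ball_def PiE_iff)
  with assms show ?thesis
    unfolding cstab_hom_def measurable_stable_def stable_def by blast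
qed

lemma cstab_homD:
  assumes "f \<in> cstab_hom P Q"
  shows "f \<in> unit_ball P \<rightarrow>\<^sub>E unit_ball Q" "pre_stable P Q f"
    and "monotone_on (unit_ball P) (cone_le P) (cone_le Q) f" "preserves_lubs P Q f"
    and "\<lbrakk>measurable_path P n \<gamma>; \<gamma> \<in> space (Rn n) \<rightarrow> unit_ball P\<rbrakk>
           \<Longrightarrow> measurable_path Q n (\<lambda>s. f (\<gamma> s))"
  using assms by (auto simp: cstab_hom_def measurable_stable_def stable_def)

lemma cstab_hom_in_ball: "f \<in> cstab_hom P Q \<Longrightarrow> x \<in> unit_ball P \<Longrightarrow> f x \<in> unit_ball Q"
  using cstab_homD(1) by blast

lemma preserves_lubsD:
  assumes "preserves_lubs P Q f" "\<And>n. x n \<in> unit_ball P" "monotone (\<le>) (cone_le P) x"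
    and "s \<in> unit_ball P" "cone_lub P x s"
  shows "cone_lub Q (\<lambda>n. f (x n)) (f s)"
  using assms by (simp add: preserves_lubs_def)

text \<open>Morphisms are restricted to the ball, so composing a path with one agrees with the plain
  expression only on the space of parameters.\<close>

lemma measurable_path_cong:
  fixes P :: "('a, 'm) mcone_scheme"
  assumes "\<And>s. s \<in> space (Rn n) \<Longrightarrow> \<gamma> s = \<delta> s"
  shows "measurable_path P n \<gamma> \<longleftrightarrow> measurable_path P n \<delta>"
proof -
  have "(\<lambda>(r, s). l r (\<gamma> s)) \<in> borel_measurable (Rn k \<Otimes>\<^sub>M Rn n) \<longleftrightarrow>
        (\<lambda>(r, s). l r (\<delta> s)) \<in> borel_measurable (Rn k \<Otimes>\<^sub>M Rn n)"
    for k and l :: "(nat \<Rightarrow> real) \<Rightarrow> 'a \<Rightarrow> real"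
    using assms by (intro measurable_cong) (auto simp: space_pair_measure)
  then show ?thesis using assms by (simp add: measurable_path_def Pi_iff)
qed

lemma unit_ball_carrier: "x \<in> unit_ball P \<Longrightarrow> x \<in> carrier P"
  by (simp add: unit_ball_def)

lemma measurable_complete_cone_pos: "measurable_complete_cone P \<Longrightarrow> pos_cone P"
  by (simp add: measurable_complete_cone_def measurable_cone_def)

lemma cstab_id_hom:
  assumes "measurable_complete_cone P"
  shows "cstab_id P \<in> cstab_hom P P"
proof (rule cstab_homI)
  have P: "pos_cone P" using assms by (rule measurable_complete_cone_pos)
  show "cstab_id P \<in> unit_ball P \<rightarrow>\<^sub>E unit_ball P"
    by (simp add: cstab_id_def)
  show "pre_stable P P (cstab_id P)"
    by (rule pre_stable_additive[OF P P, where f = "\<lambda>x. x"]) (auto simp: cstab_id_def)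
  show "monotone_on (unit_ball P) (cone_le P) (cone_le P) (cstab_id P)"
    by (simp add: cstab_id_def monotone_on_def)
  show "preserves_lubs P P (cstab_id P)"
    by (simp add: cstab_id_def preserves_lubs_def)
  fix n \<gamma> assume \<gamma>: "measurable_path P n \<gamma>" "\<gamma> \<in> space (Rn n) \<rightarrow> unit_ball P"
  then have "measurable_path P n \<gamma> \<longleftrightarrow> measurable_path P n (\<lambda>s. cstab_id P (\<gamma> s))"
    by (intro measurable_path_cong) (auto simp: cstab_id_def Pi_iff)
  with \<gamma> show "measurable_path P n (\<lambda>s. cstab_id P (\<gamma> s))" by simp
qed

lemma cstab_comp_eq: "x \<in> unit_ball P \<Longrightarrow> cstab_comp P g f x = g (f x)"
  by (simp add: cstab_comp_def compose_eq)

lemma cstab_comp_hom: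
  assumes "pos_cone P" "pos_cone Q" "pos_cone R"
    and f: "f \<in> cstab_hom P Q" and g: "g \<in> cstab_hom Q R"
  shows "cstab_comp P g f \<in> cstab_hom P R"
proof (rule cstab_homI)
  note fb = cstab_hom_in_ball[OF f] and gb = cstab_hom_in_ball[OF g]
  show "cstab_comp P g f \<in> unit_ball P \<rightarrow>\<^sub>E unit_ball R"
    using fb gb by (simp add: PiE_iff cstab_comp_eq) (simp add: cstab_comp_def compose_def)
  show "pre_stable P R (cstab_comp P g f)"
    using fb by (intro pre_stable_comp[OF assms(1-3) cstab_homD(2)[OF f] cstab_homD(2)[OF g]])
      (auto simp: cstab_comp_eq)
  show "monotone_on (unit_ball P) (cone_le P) (cone_le R) (cstab_comp P g f)"
    using cstab_homD(3)[OF f] cstab_homD(3)[OF g] fb by (simp add: monotone_on_def cstab_comp_eq)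
  show "preserves_lubs P R (cstab_comp P g f)"
    unfolding preserves_lubs_def
  proof (intro allI impI; elim conjE)
    fix x s
    assume x: "\<forall>n. x n \<in> unit_ball P" "monotone (\<le>) (cone_le P) x"
      and s: "s \<in> unit_ball P" "cone_lub P x s"
    have "cone_lub Q (\<lambda>n. f (x n)) (f s)"
      using x s by (intro preserves_lubsD[OF cstab_homD(4)[OF f]]) auto
    \<comment> \<open>Lub preservation by \<open>g\<close> is only available for non-decreasing
      sequences, so monotonicity of \<open>f\<close> is used here as well.\<close>
    moreover have "monotone (\<le>) (cone_le Q) (\<lambda>n. f (x n))"
      using x cstab_homD(3)[OF f] by (simp add: monotone_on_def)
    ultimately have "cone_lub R (\<lambda>n. g (f (x n))) (g (f s))"
      using x s fb by (intro preserves_lubsD[OF cstab_homD(4)[OF g]]) auto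
    then show "cone_lub R (\<lambda>n. cstab_comp P g f (x n)) (cstab_comp P g f s)"
      using x s by (simp add: cstab_comp_eq)
  qed
  fix n \<gamma> assume \<gamma>: "measurable_path P n \<gamma>" "\<gamma> \<in> space (Rn n) \<rightarrow> unit_ball P"
  then have "measurable_path R n (\<lambda>s. g (f (\<gamma> s)))"
    using fb by (intro cstab_homD(5)[OF g] cstab_homD(5)[OF f]) (auto simp: Pi_iff)
  moreover have "measurable_path R n (\<lambda>s. g (f (\<gamma> s)))
      \<longleftrightarrow> measurable_path R n (\<lambda>s. cstab_comp P g f (\<gamma> s))"
    using \<gamma>(2) by (intro measurable_path_cong) (auto simp: cstab_comp_eq Pi_iff)
  ultimately show "measurable_path R n (\<lambda>s. cstab_comp P g f (\<gamma> s))" by simp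
qed

lemma cstab_comp_id:
  assumes "f \<in> cstab_hom P Q"
  shows "cstab_comp P f (cstab_id P) = f" "cstab_comp P (cstab_id Q) f = f"
  using cstab_homD(1)[OF assms]
  by (auto simp: cstab_comp_def compose_def cstab_id_def PiE_iff intro!: extensionalityI[of _ "unit_ball P"])

lemma cstab_comp_assoc:
  assumes "f \<in> cstab_hom P Q"
  shows "cstab_comp P h (cstab_comp P g f) = cstab_comp P (cstab_comp Q h g) f"
  using cstab_hom_in_ball[OF assms] by (auto simp: cstab_comp_def compose_def fun_eq_iff)

section \<open>Products\<close>

lemma prod_cone_simps:
  "carrier (prod_cone I P) = (\<Pi>\<^sub>E i\<in>I. carrier (P i))"
  "\<zero>\<^bsub>prod_cone I P\<^esub> = (\<lambda>i\<in>I. \<zero>\<^bsub>P i\<^esub>)"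
  "x \<oplus>\<^bsub>prod_cone I P\<^esub> y = (\<lambda>i\<in>I. x i \<oplus>\<^bsub>P i\<^esub> y i)"
  "a \<odot>\<^bsub>prod_cone I P\<^esub> x = (\<lambda>i\<in>I. a \<odot>\<^bsub>P i\<^esub> x i)"
  by (simp_all add: prod_cone_def)

text \<open>This replaces the supremum by componentwise bounds, and the norm axioms of the product
  are derived through it. The conjunct \<open>0 \<le> B\<close> accounts for the inserted 0, which
  decides the case of the empty family.\<close>

lemma prod_cnorm_le_iff:
  assumes "finite I"
  shows "cnorm (prod_cone I P) x \<le> B \<longleftrightarrow> 0 \<le> B \<and> (\<forall>i\<in>I. cnorm (P i) (x i) \<le> B)"
  using assms by (simp add: prod_cone_def cSup_le_iff)

lemma prod_unit_ball_iff:
  assumes "finite I"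
  shows "x \<in> unit_ball (prod_cone I P) \<longleftrightarrow> x \<in> (\<Pi>\<^sub>E i\<in>I. unit_ball (P i))"
  using prod_cnorm_le_iff[OF assms, of P x 1]
  by (auto simp: unit_ball_def prod_cone_simps PiE_iff)

lemma prod_cone_le_iff:
  "cone_le (prod_cone I P) x y \<longleftrightarrow>
     x \<in> extensional I \<and> y \<in> extensional I \<and> (\<forall>i\<in>I. cone_le (P i) (x i) (y i))"
proof (intro iffI conjI)
  assume *: "x \<in> extensional I \<and> y \<in> extensional I \<and> (\<forall>i\<in>I. cone_le (P i) (x i) (y i))"
  then have "\<forall>i\<in>I. \<exists>z. z \<in> carrier (P i) \<and> y i = x i \<oplus>\<^bsub>P i\<^esub> z"
    by (auto simp: cone_le_def)
  then obtain z where z: "\<forall>i\<in>I. z i \<in> carrier (P i) \<and> y i = x i \<oplus>\<^bsub>P i\<^esub> z i"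
    by metis
  have "y = x \<oplus>\<^bsub>prod_cone I P\<^esub> (restrict z I)"
    using * z by (auto simp: prod_cone_simps intro!: extensionalityI[of _ I])
  moreover have "restrict z I \<in> carrier (prod_cone I P)"
    using z by (auto simp: prod_cone_simps)
  ultimately show "cone_le (prod_cone I P) x y"
    using * by (auto simp: cone_le_def prod_cone_simps PiE_iff)
qed (auto simp: cone_le_def prod_cone_simps PiE_iff)

text \<open>The order is componentwise, so componentwise lubs form a lub. Conversely, an upper bound
  known in one coordinate has to be extended to an upper bound in the product.\<close>

lemma prod_cone_lub_iff:
  "cone_lub (prod_cone I P) x s \<longleftrightarrow>
     (\<forall>n. x n \<in> extensional I) \<and> s \<in> extensional I \<and> (\<forall>i\<in>I. cone_lub (P i) (\<lambda>n. x n i) (s i))"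
proof (intro iffI conjI ballI)
  assume *: "cone_lub (prod_cone I P) x s"
  then show x: "\<forall>n. x n \<in> extensional I" and s: "s \<in> extensional I"
    by (auto simp: cone_lub_def prod_cone_le_iff)
  fix i assume i: "i \<in> I"
  show "cone_lub (P i) (\<lambda>n. x n i) (s i)"
    unfolding cone_lub_def
  proof (intro conjI allI impI)
    show "cone_le (P i) (x n i) (s i)" for n
      using * i by (auto simp: cone_lub_def prod_cone_le_iff)
    fix t assume t: "\<forall>n. cone_le (P i) (x n i) t"
    \<comment> \<open>Away from \<open>i\<close> the coordinates of \<open>s\<close> itself are
      kept, which are already upper bounds; minimality of \<open>s\<close> then compares
      \<open>s i\<close> with \<open>t\<close>.\<close>
    have "cone_le (prod_cone I P) (x n) (s(i := t))" for n
      using * t i s by (auto simp: cone_lub_def prod_cone_le_iff extensional_def)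
    then have "cone_le (prod_cone I P) s (s(i := t))"
      using * by (simp add: cone_lub_def)
    then show "cone_le (P i) (s i) t" using i by (auto simp: prod_cone_le_iff)
  qed
qed (auto simp: cone_lub_def prod_cone_le_iff)

text \<open>The cone order of the non-negative reals is the usual one, with witness
  \<open>y - x\<close>, so a lub of an increasing sequence is its limit. Scott continuity of a
  finite sum of functionals thereby becomes convergence of a finite sum.\<close>

lemma cone_lub_nonneg_real_iff:
  fixes a :: "nat \<Rightarrow> real"
  assumes "incseq a" "\<And>n. 0 \<le> a n"
  shows "cone_lub nonneg_real_cone a s \<longleftrightarrow> a \<longlonglongrightarrow> s"
proof -
  have le: "cone_le nonneg_real_cone x y \<longleftrightarrow> 0 \<le> x \<and> x \<le> y" for x y
    by (auto simp: cone_le_def nonneg_real_cone_def intro!: bexI[of _ "y - x"])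
  show ?thesis
  proof
    assume s: "cone_lub nonneg_real_cone a s"
    show "a \<longlonglongrightarrow> s"
    proof (rule increasing_tendsto)
      show "\<forall>\<^sub>F n in sequentially. a n \<le> s" using s by (simp add: cone_lub_def le)
      fix y assume "y < s"
      have "\<exists>n. y < a n"
      proof (rule ccontr)
        assume "\<nexists>n. y < a n"
        then have "\<forall>n. a n \<le> y" by (simp add: not_less)
        then have "s \<le> y" using s assms(2) by (simp add: cone_lub_def le)
        with \<open>y < s\<close> show False by simp
      qed
      then obtain n where "y < a n" by auto
      then have "y < a k" if "n \<le> k" for k
        using incseqD[OF assms(1) that] by simp
      then show "\<forall>\<^sub>F n in sequentially. y < a n" by (auto simp: eventually_sequentially)
    qed
  next
    assume s: "a \<longlonglongrightarrow> s"
    have "a n \<le> s" for n by (rule incseq_le[OF assms(1) s])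
    moreover have "s \<le> t" if "\<forall>n. a n \<le> t" for t
      using s that by (intro LIMSEQ_le_const2) auto
    moreover have "0 \<le> s" using assms(2)[of 0] \<open>a 0 \<le> s\<close> by simp
    ultimately show "cone_lub nonneg_real_cone a s"
      using assms(2) by (simp add: cone_lub_def le)
  qed
qed

lemma dual_cone_mono:
  assumes "\<phi> \<in> dual_cone P" "cone_le P x y"
  shows "\<phi> x \<le> \<phi> y"
proof -
  obtain z where "x \<in> carrier P" "z \<in> carrier P" "y = x \<oplus>\<^bsub>P\<^esub> z"
    using assms(2) by (auto simp: cone_le_def)
  moreover have "0 \<le> \<phi> z" using assms(1) \<open>z \<in> carrier P\<close> by (auto simp: dual_cone_def PiE_iff)
  ultimately show ?thesis using assms(1) by (simp add: dual_cone_def)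
qed

section \<open>The product of a finite family as a measurable complete cone\<close>

locale mcone_family =
  fixes I :: "'i set" and P :: "'i \<Rightarrow> 'a mcone"
  assumes finite_I: "finite I"
    and cones: "\<And>i. i \<in> I \<Longrightarrow> measurable_complete_cone (P i)"
begin

lemma pos_cones: "i \<in> I \<Longrightarrow> pos_cone (P i)"
  by (rule measurable_complete_cone_pos[OF cones])

lemma mcones: "i \<in> I \<Longrightarrow> measurable_cone (P i)"
  using cones by (simp add: measurable_complete_cone_def)

lemma abelian_monoids: "i \<in> I \<Longrightarrow> abelian_monoid (P i)"
  using pos_cones by (rule pos_cone.axioms)

lemma prod_carrier_nth: "x \<in> carrier (prod_cone I P) \<Longrightarrow> i \<in> I \<Longrightarrow> x i \<in> carrier (P i)"
  by (auto simp: prod_cone_simps)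

lemma prod_carrier_eqI:
  assumes "x \<in> carrier (prod_cone I P)" "y \<in> carrier (prod_cone I P)" "\<And>i. i \<in> I \<Longrightarrow> x i = y i"
  shows "x = y"
  using assms by (auto simp: prod_cone_simps intro: PiE_ext)

lemma prod_abelian_monoid: "abelian_monoid (prod_cone I P)"
proof (rule abelian_monoidI)
  show "x \<oplus>\<^bsub>prod_cone I P\<^esub> y \<in> carrier (prod_cone I P)"
    if "x \<in> carrier (prod_cone I P)" "y \<in> carrier (prod_cone I P)" for x y
    using that abelian_monoids
    by (auto simp: prod_cone_simps PiE_iff intro!: abelian_monoid.a_closed)
  show "\<zero>\<^bsub>prod_cone I P\<^esub> \<in> carrier (prod_cone I P)"
    using abelian_monoids by (auto simp: prod_cone_simps intro!: abelian_monoid.zero_closed)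
  show "(x \<oplus>\<^bsub>prod_cone I P\<^esub> y) \<oplus>\<^bsub>prod_cone I P\<^esub> z = x \<oplus>\<^bsub>prod_cone I P\<^esub> (y \<oplus>\<^bsub>prod_cone I P\<^esub> z)"
    if "x \<in> carrier (prod_cone I P)" "y \<in> carrier (prod_cone I P)" "z \<in> carrier (prod_cone I P)" for x y z
    using that abelian_monoids
    by (auto simp: prod_cone_simps PiE_iff intro!: restrict_ext abelian_monoid.a_assoc)
  show "\<zero>\<^bsub>prod_cone I P\<^esub> \<oplus>\<^bsub>prod_cone I P\<^esub> x = x" if "x \<in> carrier (prod_cone I P)" for x
    using that abelian_monoids
    by (auto simp: prod_cone_simps PiE_iff intro!: extensionalityI[of _ I] abelian_monoid.l_zero)
  show "x \<oplus>\<^bsub>prod_cone I P\<^esub> y = y \<oplus>\<^bsub>prod_cone I P\<^esub> x"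
    if "x \<in> carrier (prod_cone I P)" "y \<in> carrier (prod_cone I P)" for x y
    using that abelian_monoids
    by (auto simp: prod_cone_simps PiE_iff intro!: restrict_ext abelian_monoid.a_comm)
qed

lemma prod_cnorm_ge: "i \<in> I \<Longrightarrow> cnorm (P i) (x i) \<le> cnorm (prod_cone I P) x"
  and prod_cnorm_nonneg: "0 \<le> cnorm (prod_cone I P) x"
  using prod_cnorm_le_iff[OF finite_I, of P x "cnorm (prod_cone I P) x"] by auto

lemma prod_pos_cone: "pos_cone (prod_cone I P)"
proof (intro pos_cone.intro prod_abelian_monoid pos_cone_axioms.intro)
  let ?Q = "prod_cone I P"
  note nth = prod_carrier_nth
  fix a b :: real and x x' y z
  show "x \<in> carrier ?Q \<Longrightarrow> 0 \<le> cnorm ?Q x" by (rule prod_cnorm_nonneg)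
  show smult: "a \<odot>\<^bsub>?Q\<^esub> x \<in> carrier ?Q" if "0 \<le> a" "x \<in> carrier ?Q" for a x
    using that nth pos_cones by (auto simp: prod_cone_simps(1,4) intro!: pos_cone.smult_closed)
  show "(a + b) \<odot>\<^bsub>?Q\<^esub> x = a \<odot>\<^bsub>?Q\<^esub> x \<oplus>\<^bsub>?Q\<^esub> b \<odot>\<^bsub>?Q\<^esub> x" if "0 \<le> a" "0 \<le> b" "x \<in> carrier ?Q"
    using that nth pos_cones
    by (auto simp: prod_cone_simps(3,4) intro!: restrict_ext pos_cone.smult_l_distr)
  show "a \<odot>\<^bsub>?Q\<^esub> (x \<oplus>\<^bsub>?Q\<^esub> y) = a \<odot>\<^bsub>?Q\<^esub> x \<oplus>\<^bsub>?Q\<^esub> a \<odot>\<^bsub>?Q\<^esub> y"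
    if "0 \<le> a" "x \<in> carrier ?Q" "y \<in> carrier ?Q"
    using that nth pos_cones
    by (auto simp: prod_cone_simps(3,4) intro!: restrict_ext pos_cone.smult_r_distr)
  show "(a * b) \<odot>\<^bsub>?Q\<^esub> x = a \<odot>\<^bsub>?Q\<^esub> (b \<odot>\<^bsub>?Q\<^esub> x)" if "0 \<le> a" "0 \<le> b" "x \<in> carrier ?Q"
    using that nth pos_cones
    by (auto simp: prod_cone_simps(4) intro!: restrict_ext pos_cone.smult_assoc)
  show "1 \<odot>\<^bsub>?Q\<^esub> x = x" if "x \<in> carrier ?Q"
    using that pos_cones
    by (auto simp: prod_cone_simps(1,4) PiE_iff intro!: extensionalityI[of _ I] pos_cone.smult_one)
  show "0 \<odot>\<^bsub>?Q\<^esub> x = \<zero>\<^bsub>?Q\<^esub>" if "x \<in> carrier ?Q"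
    using that nth pos_cones
    by (auto simp: prod_cone_simps(2,4) intro!: restrict_ext pos_cone.smult_zero_left)
  show "a \<odot>\<^bsub>?Q\<^esub> \<zero>\<^bsub>?Q\<^esub> = \<zero>\<^bsub>?Q\<^esub>" if "0 \<le> a"
    using that pos_cones
    by (auto simp: prod_cone_simps(2,4) intro!: restrict_ext pos_cone.smult_zero_right)
  show "y = z" if "x \<in> carrier ?Q" "y \<in> carrier ?Q" "z \<in> carrier ?Q" "x \<oplus>\<^bsub>?Q\<^esub> y = x \<oplus>\<^bsub>?Q\<^esub> z"
  proof (rule prod_carrier_eqI[OF that(2,3)])
    fix i assume i: "i \<in> I"
    have "x i \<oplus>\<^bsub>P i\<^esub> y i = x i \<oplus>\<^bsub>P i\<^esub> z i"
      using fun_cong[OF that(4), of i] i by (simp add: prod_cone_simps)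
    then show "y i = z i"
      using pos_cone.cancellation[OF pos_cones[OF i]] nth that i by blast
  qed
  show "cnorm ?Q (a \<odot>\<^bsub>?Q\<^esub> x) = a * cnorm ?Q x" if a: "0 \<le> a" and x: "x \<in> carrier ?Q"
  proof (rule antisym)
    have eq: "cnorm (P i) ((a \<odot>\<^bsub>?Q\<^esub> x) i) = a * cnorm (P i) (x i)" if "i \<in> I" for i
      using that a nth[OF x that] pos_cone.cnorm_smult[OF pos_cones[OF that]]
      by (simp add: prod_cone_simps)
    show "cnorm ?Q (a \<odot>\<^bsub>?Q\<^esub> x) \<le> a * cnorm ?Q x"
      unfolding prod_cnorm_le_iff[OF finite_I]
      using a prod_cnorm_nonneg by (simp add: eq prod_cnorm_ge mult_left_mono)
    show "a * cnorm ?Q x \<le> cnorm ?Q (a \<odot>\<^bsub>?Q\<^esub> x)"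
    \<comment> \<open>Bounding the supremum from this side requires dividing the componentwise
      bounds by \<open>a\<close>, so \<open>a = 0\<close> is treated apart.\<close>
    proof (cases "a = 0")
      case False
      with a have "0 < a" by simp
      have "cnorm (P i) (x i) \<le> cnorm ?Q (a \<odot>\<^bsub>?Q\<^esub> x) / a" if "i \<in> I" for i
        using prod_cnorm_ge[OF that, of "a \<odot>\<^bsub>?Q\<^esub> x"] \<open>0 < a\<close> eq[OF that]
        by (simp add: pos_le_divide_eq mult.commute)
      then have "cnorm ?Q x \<le> cnorm ?Q (a \<odot>\<^bsub>?Q\<^esub> x) / a"
        using \<open>0 < a\<close> prod_cnorm_nonneg by (simp add: prod_cnorm_le_iff[OF finite_I])
      then show ?thesis using \<open>0 < a\<close> by (simp add: pos_le_divide_eq mult.commute)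
    qed (simp add: prod_cnorm_nonneg)
  qed
  show "x = \<zero>\<^bsub>?Q\<^esub>" if x: "x \<in> carrier ?Q" and "cnorm ?Q x = 0"
  proof (rule prod_carrier_eqI[OF x abelian_monoid.zero_closed[OF prod_abelian_monoid]])
    fix i assume i: "i \<in> I"
    have "cnorm (P i) (x i) = 0"
      using prod_cnorm_ge[OF i, of x] that(2) pos_cone.cnorm_nonneg[OF pos_cones[OF i] nth[OF x i]]
      by simp
    then show "x i = \<zero>\<^bsub>?Q\<^esub> i"
      using i nth[OF x i] pos_cone.cnorm_eq_zero[OF pos_cones[OF i]]
      by (simp add: prod_cone_simps)
  qed
  show "cnorm ?Q (x \<oplus>\<^bsub>?Q\<^esub> x') \<le> cnorm ?Q x + cnorm ?Q x'"
    if x: "x \<in> carrier ?Q" "x' \<in> carrier ?Q"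
    unfolding prod_cnorm_le_iff[OF finite_I]
  proof (intro conjI ballI)
    fix i assume i: "i \<in> I"
    have "cnorm (P i) (x i \<oplus>\<^bsub>P i\<^esub> x' i) \<le> cnorm (P i) (x i) + cnorm (P i) (x' i)"
      using nth x i by (intro pos_cone.cnorm_triangle pos_cones) auto
    also have "\<dots> \<le> cnorm ?Q x + cnorm ?Q x'"
      using i by (intro add_mono prod_cnorm_ge)
    finally show "cnorm (P i) ((x \<oplus>\<^bsub>?Q\<^esub> x') i) \<le> cnorm ?Q x + cnorm ?Q x'"
      using i by (simp add: prod_cone_simps)
  qed (simp add: prod_cnorm_nonneg)
  show "cnorm ?Q x \<le> cnorm ?Q (x \<oplus>\<^bsub>?Q\<^esub> x')" if x: "x \<in> carrier ?Q" "x' \<in> carrier ?Q"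
  proof -
    have "cnorm (P i) (x i) \<le> cnorm ?Q (x \<oplus>\<^bsub>?Q\<^esub> x')" if i: "i \<in> I" for i
    proof -
      have "cnorm (P i) (x i) \<le> cnorm (P i) (x i \<oplus>\<^bsub>P i\<^esub> x' i)"
        using nth x i by (intro pos_cone.cnorm_mono pos_cones) auto
      also have "\<dots> = cnorm (P i) ((x \<oplus>\<^bsub>?Q\<^esub> x') i)" using i by (simp add: prod_cone_simps)
      also have "\<dots> \<le> cnorm ?Q (x \<oplus>\<^bsub>?Q\<^esub> x')" by (rule prod_cnorm_ge[OF i])
      finally show ?thesis .
    qed
    then show ?thesis by (simp add: prod_cnorm_le_iff[OF finite_I] prod_cnorm_nonneg)
  qed
qed

lemma prod_complete_cone: "complete_cone (prod_cone I P)"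
proof (intro complete_cone.intro prod_pos_cone complete_cone_axioms.intro)
  fix x :: "nat \<Rightarrow> 'i \<Rightarrow> 'a"
  assume x: "\<And>n. x n \<in> unit_ball (prod_cone I P)" "monotone (\<le>) (cone_le (prod_cone I P)) x"
  have "\<exists>s\<in>unit_ball (P i). cone_lub (P i) (\<lambda>n. x n i) s" if i: "i \<in> I" for i
  proof (rule complete_cone.complete)
    show "complete_cone (P i)" using cones[OF i] by (simp add: measurable_complete_cone_def)
    show "x n i \<in> unit_ball (P i)" for n using x(1)[of n] i by (auto simp: prod_unit_ball_iff finite_I)
    show "monotone (\<le>) (cone_le (P i)) (\<lambda>n. x n i)"
      using x(2) i by (simp add: monotone_on_def prod_cone_le_iff)
  qed
  then obtain s where s: "\<And>i. i \<in> I \<Longrightarrow> s i \<in> unit_ball (P i)"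
    "\<And>i. i \<in> I \<Longrightarrow> cone_lub (P i) (\<lambda>n. x n i) (s i)" by metis
  have "x n \<in> extensional I" for n using x(1)[of n] by (auto simp: prod_unit_ball_iff finite_I PiE_iff)
  then have "cone_lub (prod_cone I P) x (restrict s I)" "restrict s I \<in> unit_ball (prod_cone I P)"
    using s by (auto simp: prod_cone_lub_iff prod_unit_ball_iff finite_I)
  then show "\<exists>s\<in>unit_ball (prod_cone I P). cone_lub (prod_cone I P) x s" by blast
qed

text \<open>Additivity and homogeneity pass to finite sums directly. For lubs, each component yields
  an increasing real sequence converging to its lub; the limits add up, and the limit of the
  increasing sum is again its lub.\<close>

lemma prod_dual_cone:
  assumes \<phi>: "\<And>i. i \<in> I \<Longrightarrow> \<phi> i \<in> dual_cone (P i)"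
  shows "(\<lambda>x\<in>carrier (prod_cone I P). \<Sum>i\<in>I. \<phi> i (x i)) \<in> dual_cone (prod_cone I P)"
    (is "?\<Phi> \<in> _")
proof -
  let ?Q = "prod_cone I P"
  interpret Q: pos_cone ?Q by (rule prod_pos_cone)
  note nth = prod_carrier_nth
  have \<phi>_nonneg: "0 \<le> \<phi> i y" if "i \<in> I" "y \<in> carrier (P i)" for i y
    using \<phi>[OF that(1)] that(2) by (auto simp: dual_cone_def PiE_iff)
  have nonneg: "0 \<le> (\<Sum>i\<in>I. \<phi> i (x i))" if "x \<in> carrier ?Q" for x
    using that nth by (intro sum_nonneg \<phi>_nonneg)
  have add: "?\<Phi> (x \<oplus>\<^bsub>?Q\<^esub> y) = ?\<Phi> x + ?\<Phi> y" if "x \<in> carrier ?Q" "y \<in> carrier ?Q" for x y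
  proof -
    have "\<phi> i ((x \<oplus>\<^bsub>?Q\<^esub> y) i) = \<phi> i (x i) + \<phi> i (y i)" if i: "i \<in> I" for i
      using \<phi>[OF i] nth i \<open>x \<in> carrier ?Q\<close> \<open>y \<in> carrier ?Q\<close> by (simp add: dual_cone_def prod_cone_simps(3))
    then show ?thesis using that by (simp add: sum.distrib)
  qed
  have smult: "?\<Phi> (a \<odot>\<^bsub>?Q\<^esub> x) = a * ?\<Phi> x" if "0 \<le> a" "x \<in> carrier ?Q" for a x
  proof -
    have "\<phi> i ((a \<odot>\<^bsub>?Q\<^esub> x) i) = a * \<phi> i (x i)" if i: "i \<in> I" for i
      using \<phi>[OF i] nth i \<open>0 \<le> a\<close> \<open>x \<in> carrier ?Q\<close> by (simp add: dual_cone_def prod_cone_simps(4))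
    then show ?thesis using that by (simp add: sum_distrib_left Q.smult_closed)
  qed
  have "preserves_lubs ?Q nonneg_real_cone ?\<Phi>"
    unfolding preserves_lubs_def
  proof (intro allI impI; elim conjE)
    fix x s
    assume x: "\<forall>n. x n \<in> unit_ball ?Q" "monotone (\<le>) (cone_le ?Q) x"
      and s: "s \<in> unit_ball ?Q" "cone_lub ?Q x s"
    have xc: "x n \<in> carrier ?Q" for n using x(1) by (auto intro: unit_ball_carrier)
    have sc: "s \<in> carrier ?Q" using s(1) by (rule unit_ball_carrier)
    have inc: "incseq (\<lambda>n. \<phi> i (x n i))" if i: "i \<in> I" for i
      using x(2) i by (auto simp: incseq_def monotone_on_def prod_cone_le_iff intro!: dual_cone_mono[OF \<phi>])
    have "(\<lambda>n. \<phi> i (x n i)) \<longlonglongrightarrow> \<phi> i (s i)" if i: "i \<in> I" for i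
    proof -
      have "cone_lub nonneg_real_cone (\<lambda>n. \<phi> i (x n i)) (\<phi> i (s i))"
      proof (rule preserves_lubsD[where x = "\<lambda>n. x n i"])
        show "preserves_lubs (P i) nonneg_real_cone (\<phi> i)" using \<phi>[OF i] by (simp add: dual_cone_def)
        show "x n i \<in> unit_ball (P i)" for n
          using x(1) i by (auto simp: prod_unit_ball_iff finite_I)
        show "s i \<in> unit_ball (P i)" using s(1) i by (auto simp: prod_unit_ball_iff finite_I)
        show "monotone (\<le>) (cone_le (P i)) (\<lambda>n. x n i)"
          using x(2) i by (simp add: monotone_on_def prod_cone_le_iff)
        show "cone_lub (P i) (\<lambda>n. x n i) (s i)" using s(2) i by (simp add: prod_cone_lub_iff)
      qed
      then show ?thesis
        using cone_lub_nonneg_real_iff[OF inc[OF i]] \<phi>_nonneg[OF i] nth[OF xc i] by blast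
    qed
    then have "(\<lambda>n. \<Sum>i\<in>I. \<phi> i (x n i)) \<longlonglongrightarrow> (\<Sum>i\<in>I. \<phi> i (s i))"
      by (rule tendsto_sum)
    moreover have "incseq (\<lambda>n. \<Sum>i\<in>I. \<phi> i (x n i))"
      using inc by (auto simp: incseq_def intro!: sum_mono)
    ultimately have "cone_lub nonneg_real_cone (\<lambda>n. \<Sum>i\<in>I. \<phi> i (x n i)) (\<Sum>i\<in>I. \<phi> i (s i))"
      using cone_lub_nonneg_real_iff nonneg[OF xc] by blast
    then show "cone_lub nonneg_real_cone (\<lambda>n. ?\<Phi> (x n)) (?\<Phi> s)"
      using xc sc by simp
  qed
  with nonneg add smult show ?thesis by (simp add: dual_cone_def)
qed

lemma prod_mtests:
  "mtests (prod_cone I P) n =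
     {\<lambda>r\<in>space (Rn n). \<lambda>x\<in>carrier (prod_cone I P). \<Sum>i\<in>I. l i r (x i) |l.
        \<forall>i\<in>I. l i \<in> mtests (P i) n}"
  by (simp add: prod_cone_def)

text \<open>A test of the product is a family of tests of the components, and each closure condition
  is met by acting on that family: zero tests give the zero test, and precomposition is done in
  every component.\<close>

lemma prod_measurable_cone: "measurable_cone (prod_cone I P)"
proof (intro measurable_cone.intro prod_pos_cone measurable_cone_axioms.intro)
  let ?Q = "prod_cone I P"
  fix n p
  show "mtests ?Q n \<subseteq> space (Rn n) \<rightarrow>\<^sub>E dual_cone ?Q"
  proof
    fix t assume "t \<in> mtests ?Q n"
    then obtain l where t: "t = (\<lambda>r\<in>space (Rn n). \<lambda>x\<in>carrier ?Q. \<Sum>i\<in>I. l i r (x i))"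
      and l: "\<And>i. i \<in> I \<Longrightarrow> l i \<in> mtests (P i) n" unfolding prod_mtests by blast
    have "l i r \<in> dual_cone (P i)" if "i \<in> I" "r \<in> space (Rn n)" for i r
      using measurable_cone.mtests_dual[OF mcones[OF that(1)], of n] l[OF that(1)] that(2) by blast
    then show "t \<in> space (Rn n) \<rightarrow>\<^sub>E dual_cone ?Q"
      unfolding t by (auto intro!: prod_dual_cone)
  qed
  show "(\<lambda>r\<in>space (Rn n). \<lambda>x\<in>carrier ?Q. 0) \<in> mtests ?Q n"
    unfolding prod_mtests
    using mcones prod_carrier_nth
    by (intro CollectI exI[of _ "\<lambda>i. \<lambda>r\<in>space (Rn n). \<lambda>x\<in>carrier (P i). 0"])
      (auto intro!: restrict_ext measurable_cone.mtests_zero)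
  show "(\<lambda>r\<in>space (Rn p). t (h r)) \<in> mtests ?Q p"
    if "t \<in> mtests ?Q n" and h: "h \<in> Rn p \<rightarrow>\<^sub>M Rn n" for t h
  proof -
    from that(1) obtain l where t: "t = (\<lambda>r\<in>space (Rn n). \<lambda>x\<in>carrier ?Q. \<Sum>i\<in>I. l i r (x i))"
      and l: "\<And>i. i \<in> I \<Longrightarrow> l i \<in> mtests (P i) n" unfolding prod_mtests by blast
    let ?l = "\<lambda>i. \<lambda>r\<in>space (Rn p). l i (h r)"
    have "(\<lambda>r\<in>space (Rn p). t (h r)) = (\<lambda>r\<in>space (Rn p). \<lambda>x\<in>carrier ?Q. \<Sum>i\<in>I. ?l i r (x i))"
      using measurable_space[OF h] by (auto simp: t intro!: restrict_ext)
    moreover have "\<forall>i\<in>I. ?l i \<in> mtests (P i) p"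
      using l h mcones by (auto intro!: measurable_cone.mtests_precompose)
    ultimately show ?thesis
      unfolding prod_mtests by (intro CollectI exI[of _ ?l] conjI)
  qed
  show "(\<lambda>r. t r x) \<in> borel_measurable (Rn n)" if "t \<in> mtests ?Q n" and x: "x \<in> carrier ?Q" for t x
  proof -
    from that(1) obtain l where t: "t = (\<lambda>r\<in>space (Rn n). \<lambda>x\<in>carrier ?Q. \<Sum>i\<in>I. l i r (x i))"
      and l: "\<And>i. i \<in> I \<Longrightarrow> l i \<in> mtests (P i) n" unfolding prod_mtests by blast
    have "(\<lambda>r. \<Sum>i\<in>I. l i r (x i)) \<in> borel_measurable (Rn n)"
      using l prod_carrier_nth[OF x] mcones
      by (intro borel_measurable_sum measurable_cone.mtests_measurable)
    then show ?thesis
      using x by (subst measurable_cong[where g = "\<lambda>r. \<Sum>i\<in>I. l i r (x i)"]) (auto simp: t)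
  qed
qed

lemma prod_measurable_complete_cone: "measurable_complete_cone (prod_cone I P)"
  by (intro measurable_complete_cone.intro prod_measurable_cone prod_complete_cone)

section \<open>Projections, tupling and the universal property\<close>

lemma prod_finsum_nth:
  assumes i: "i \<in> I" and F: "F \<in> A \<rightarrow> carrier (prod_cone I P)"
  shows "(\<Oplus>\<^bsub>prod_cone I P\<^esub>a\<in>A. F a) i = (\<Oplus>\<^bsub>P i\<^esub>a\<in>A. F a i)"
  using F
proof (induction A rule: infinite_finite_induct)
  interpret Q: abelian_monoid "prod_cone I P" by (rule prod_abelian_monoid)
  interpret Pi: abelian_monoid "P i" by (rule abelian_monoids[OF i])
  {
    \<comment> \<open>Here both sums take the default value zero.\<close>
    case (infinite A)
    then show ?case using i by (simp add: Q.finsum_infinite Pi.finsum_infinite prod_cone_simps)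
  next
    case empty
    show ?case using i by (simp add: prod_cone_simps)
  next
    case (insert a A)
    have FA: "F \<in> A \<rightarrow> carrier (prod_cone I P)" "F a \<in> carrier (prod_cone I P)"
      using insert.prems by auto
    then have "(\<lambda>b. F b i) \<in> A \<rightarrow> carrier (P i)" "F a i \<in> carrier (P i)"
      using prod_carrier_nth i by auto
    with FA insert show ?case using i by (simp add: prod_cone_simps(3))
  }
qed

lemma proj_hom:
  assumes i: "i \<in> I"
  shows "cstab_proj I P i \<in> cstab_hom (prod_cone I P) (P i)"
proof (rule cstab_homI)
  let ?Q = "prod_cone I P"
  have nth: "x i \<in> unit_ball (P i)" if "x \<in> unit_ball ?Q" for x
    using that i by (auto simp: prod_unit_ball_iff finite_I)
  show "cstab_proj I P i \<in> unit_ball ?Q \<rightarrow>\<^sub>E unit_ball (P i)"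
    using nth by (simp add: cstab_proj_def)
  show "pre_stable ?Q (P i) (cstab_proj I P i)"
    using i by (intro pre_stable_additive[OF prod_pos_cone pos_cones[OF i], where f = "\<lambda>x. x i"])
      (auto simp: cstab_proj_def prod_cone_simps)
  show "monotone_on (unit_ball ?Q) (cone_le ?Q) (cone_le (P i)) (cstab_proj I P i)"
    using i by (simp add: monotone_on_def cstab_proj_def prod_cone_le_iff)
  show "preserves_lubs ?Q (P i) (cstab_proj I P i)"
    using i by (simp add: preserves_lubs_def cstab_proj_def prod_cone_lub_iff)
  fix n \<gamma>
  assume \<gamma>: "measurable_path ?Q n \<gamma>" "\<gamma> \<in> space (Rn n) \<rightarrow> unit_ball ?Q"
  have \<gamma>c: "\<gamma> s \<in> carrier ?Q" if "s \<in> space (Rn n)" for s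
    using \<gamma>(2) that by (auto intro: unit_ball_carrier)
  have "measurable_path (P i) n (\<lambda>s. \<gamma> s i)"
    unfolding measurable_path_def
  proof (intro conjI allI ballI)
    show "(\<lambda>s. \<gamma> s i) \<in> space (Rn n) \<rightarrow> carrier (P i)"
      using prod_carrier_nth[OF \<gamma>c i] by auto
    show "\<exists>B. \<forall>s\<in>space (Rn n). cnorm (P i) (\<gamma> s i) \<le> B"
      using nth \<gamma>(2) by (intro exI[of _ 1]) (auto simp: unit_ball_def Pi_iff)
    fix k l assume l: "l \<in> mtests (P i) k"
    \<comment> \<open>A path in the product is only known to be measurable against sums of tests.
      Taking the zero test in all other components isolates the given test of component
      \<open>i\<close>.\<close>
    define l' where
      "l' j = (if j = i then l else (\<lambda>r\<in>space (Rn k). \<lambda>x\<in>carrier (P j). 0))" for j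
    have l': "\<forall>j\<in>I. l' j \<in> mtests (P j) k"
      using l mcones by (auto simp: l'_def intro!: measurable_cone.mtests_zero)
    define t where "t = (\<lambda>r\<in>space (Rn k). \<lambda>x\<in>carrier ?Q. \<Sum>j\<in>I. l' j r (x j))"
    have "t \<in> mtests ?Q k" unfolding prod_mtests t_def using l' by blast
    then have "(\<lambda>(r, s). t r (\<gamma> s)) \<in> borel_measurable (Rn k \<Otimes>\<^sub>M Rn n)"
      using \<gamma>(1) by (simp add: measurable_path_def)
    moreover have "t r (\<gamma> s) = l r (\<gamma> s i)" if r: "r \<in> space (Rn k)" and s: "s \<in> space (Rn n)" for r s
    proof -
      have "(\<Sum>j\<in>I. l' j r (\<gamma> s j)) = (\<Sum>j\<in>I. if j = i then l r (\<gamma> s i) else 0)"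
        using r prod_carrier_nth[OF \<gamma>c[OF s]] by (intro sum.cong) (auto simp: l'_def)
      then show ?thesis using r \<gamma>c[OF s] i finite_I by (simp add: t_def)
    qed
    ultimately show "(\<lambda>(r, s). l r (\<gamma> s i)) \<in> borel_measurable (Rn k \<Otimes>\<^sub>M Rn n)"
      by (subst measurable_cong[where g = "\<lambda>(r, s). t r (\<gamma> s)"]) (auto simp: space_pair_measure)
  qed
  moreover have "measurable_path (P i) n (\<lambda>s. \<gamma> s i)
      \<longleftrightarrow> measurable_path (P i) n (\<lambda>s. cstab_proj I P i (\<gamma> s))"
    using \<gamma>(2) by (intro measurable_path_cong) (auto simp: cstab_proj_def Pi_iff)
  ultimately show "measurable_path (P i) n (\<lambda>s. cstab_proj I P i (\<gamma> s))" by simp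
qed

text \<open>Both the finite sums and the order of the product are computed componentwise, so the
  inequality may be checked in each component.\<close>

lemma pre_stable_prod:
  assumes "pos_cone Y" and f: "f \<in> unit_ball Y \<rightarrow> carrier (prod_cone I P)"
    and fi: "\<And>i. i \<in> I \<Longrightarrow> pre_stable Y (P i) (\<lambda>y. f y i)"
  shows "pre_stable Y (prod_cone I P) f"
  unfolding pre_stable_def
proof (intro conjI f allI ballI impI)
  interpret Y: pos_cone Y by fact
  let ?Q = "prod_cone I P"
  interpret Q: pos_cone ?Q by (rule prod_pos_cone)
  fix n :: nat and u x
  assume n: "1 \<le> n" and u: "u \<in> {1..n} \<rightarrow> carrier Y" and x: "x \<in> carrier Y"
    and ball: "x \<oplus>\<^bsub>Y\<^esub> (\<Oplus>\<^bsub>Y\<^esub>i\<in>{1..n}. u i) \<in> unit_ball Y"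
  let ?F = "\<lambda>J. f (x \<oplus>\<^bsub>Y\<^esub> (\<Oplus>\<^bsub>Y\<^esub>j\<in>J. u j))"
  let ?odd = "{J. J \<subseteq> {1..n} \<and> odd (n - card J)}" and ?even = "{J. J \<subseteq> {1..n} \<and> even (n - card J)}"
  have "?F J \<in> carrier ?Q" if "J \<subseteq> {1..n}" for J
    using f Y.partial_sum_in_ball[OF _ u x ball that] by auto
  then have F: "?F \<in> ?odd \<rightarrow> carrier ?Q" "?F \<in> ?even \<rightarrow> carrier ?Q" by auto
  have "cone_le (P i) ((\<Oplus>\<^bsub>?Q\<^esub>J\<in>?odd. ?F J) i) ((\<Oplus>\<^bsub>?Q\<^esub>J\<in>?even. ?F J) i)" if i: "i \<in> I" for i
    unfolding prod_finsum_nth[OF i F(1)] prod_finsum_nth[OF i F(2)]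
    using fi[OF i] n u x ball unfolding pre_stable_def by blast
  moreover have "(\<Oplus>\<^bsub>?Q\<^esub>J\<in>?odd. ?F J) \<in> extensional I" "(\<Oplus>\<^bsub>?Q\<^esub>J\<in>?even. ?F J) \<in> extensional I"
    using Q.finsum_closed[OF F(1)] Q.finsum_closed[OF F(2)] by (auto simp: prod_cone_simps PiE_iff)
  ultimately show "cone_le ?Q (\<Oplus>\<^bsub>?Q\<^esub>J\<in>?odd. ?F J) (\<Oplus>\<^bsub>?Q\<^esub>J\<in>?even. ?F J)"
    unfolding prod_cone_le_iff by blast
qed

lemma tuple_hom:
  assumes "pos_cone Y" and f: "\<And>i. i \<in> I \<Longrightarrow> f i \<in> cstab_hom Y (P i)"
  shows "cstab_tuple I Y f \<in> cstab_hom Y (prod_cone I P)"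
proof (rule cstab_homI)
  let ?Q = "prod_cone I P" and ?h = "cstab_tuple I Y f"
  interpret Y: pos_cone Y by fact
  have h: "?h y = (\<lambda>i\<in>I. f i y)" if "y \<in> unit_ball Y" for y
    using that by (simp add: cstab_tuple_def)
  have hb: "?h y \<in> unit_ball ?Q" if "y \<in> unit_ball Y" for y
  proof -
    have "f i y \<in> unit_ball (P i)" if "i \<in> I" for i
      by (rule cstab_hom_in_ball[OF f[OF that] \<open>y \<in> unit_ball Y\<close>])
    with that show ?thesis by (simp add: h prod_unit_ball_iff finite_I)
  qed
  then show "?h \<in> unit_ball Y \<rightarrow>\<^sub>E unit_ball ?Q"
    by (simp add: PiE_iff) (simp add: cstab_tuple_def)
  show "pre_stable Y ?Q ?h"
  proof (rule pre_stable_prod)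
    show "?h \<in> unit_ball Y \<rightarrow> carrier ?Q" using hb by (auto intro: unit_ball_carrier)
    fix i assume i: "i \<in> I"
    show "pre_stable Y (P i) (\<lambda>y. ?h y i)"
    \<comment> \<open>The component of the tuple equals \<open>f i\<close> only on the ball.
      Composing \<open>f i\<close> with the identity lets the composition lemma transfer
      pre-stability across this agreement.\<close>
    proof (rule pre_stable_comp[OF assms(1) assms(1) pos_cones[OF i]])
      show "pre_stable Y Y (\<lambda>y. y)"
        by (rule pre_stable_additive[where f = "\<lambda>y. y"]) (use assms(1) in auto)
      show "pre_stable Y (P i) (f i)" by (rule cstab_homD(2)[OF f[OF i]])
    qed (auto simp: h i)
  qed (rule assms(1))
  have "cone_le (P i) (f i x) (f i y)"
    if "i \<in> I" "x \<in> unit_ball Y" "y \<in> unit_ball Y" "cone_le Y x y" for i x y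
    using cstab_homD(3)[OF f[OF that(1)]] that by (simp add: monotone_on_def)
  then show "monotone_on (unit_ball Y) (cone_le Y) (cone_le ?Q) ?h"
    by (simp add: monotone_on_def prod_cone_le_iff h)
  have "cone_lub (P i) (\<lambda>n. f i (x n)) (f i s)"
    if "i \<in> I" "\<And>n. x n \<in> unit_ball Y" "monotone (\<le>) (cone_le Y) x" "s \<in> unit_ball Y" "cone_lub Y x s"
    for i x s
    using that by (intro preserves_lubsD[OF cstab_homD(4)[OF f]])
  then show "preserves_lubs Y ?Q ?h"
    by (simp add: preserves_lubs_def prod_cone_lub_iff h)
  fix n \<gamma>
  assume \<gamma>: "measurable_path Y n \<gamma>" "\<gamma> \<in> space (Rn n) \<rightarrow> unit_ball Y"
  have \<gamma>b: "\<gamma> s \<in> unit_ball Y" if "s \<in> space (Rn n)" for s using \<gamma>(2) that by auto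
  show "measurable_path ?Q n (\<lambda>s. ?h (\<gamma> s))"
    unfolding measurable_path_def
  proof (intro conjI allI ballI)
    show "(\<lambda>s. ?h (\<gamma> s)) \<in> space (Rn n) \<rightarrow> carrier ?Q"
      using hb \<gamma>b by (auto intro: unit_ball_carrier)
    show "\<exists>B. \<forall>s\<in>space (Rn n). cnorm ?Q (?h (\<gamma> s)) \<le> B"
      using hb \<gamma>b by (intro exI[of _ 1]) (auto simp: unit_ball_def)
    fix k t assume "t \<in> mtests ?Q k"
    then obtain l where t: "t = (\<lambda>r\<in>space (Rn k). \<lambda>x\<in>carrier ?Q. \<Sum>i\<in>I. l i r (x i))"
      and l: "\<And>i. i \<in> I \<Longrightarrow> l i \<in> mtests (P i) k" unfolding prod_mtests by blast
    have "(\<lambda>(r, s). l i r (f i (\<gamma> s))) \<in> borel_measurable (Rn k \<Otimes>\<^sub>M Rn n)" if i: "i \<in> I" for i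
      using cstab_homD(5)[OF f[OF i] \<gamma>] l[OF i] by (simp add: measurable_path_def)
    \<comment> \<open>Applying a product test to the tuple gives a finite sum of component tests
      along the paths \<open>f i (\<gamma> s)\<close>, each jointly measurable because
      \<open>f i\<close> preserves measurable paths.\<close>
    then have "(\<lambda>z. \<Sum>i\<in>I. (\<lambda>(r, s). l i r (f i (\<gamma> s))) z) \<in> borel_measurable (Rn k \<Otimes>\<^sub>M Rn n)"
      by (rule borel_measurable_sum)
    moreover have "t r (?h (\<gamma> s)) = (\<Sum>i\<in>I. l i r (f i (\<gamma> s)))"
      if "r \<in> space (Rn k)" "s \<in> space (Rn n)" for r s
      using that unit_ball_carrier[OF hb[OF \<gamma>b[OF that(2)]]] \<gamma>b by (simp add: t h)
    ultimately show "(\<lambda>(r, s). t r (?h (\<gamma> s))) \<in> borel_measurable (Rn k \<Otimes>\<^sub>M Rn n)"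
      by (subst measurable_cong[where g = "\<lambda>z. \<Sum>i\<in>I. (\<lambda>(r, s). l i r (f i (\<gamma> s))) z"])
        (auto simp: space_pair_measure)
  qed
qed

lemma proj_tuple:
  assumes f: "\<And>i. i \<in> I \<Longrightarrow> f i \<in> cstab_hom Y (P i)" and i: "i \<in> I"
  shows "cstab_comp Y (cstab_proj I P i) (cstab_tuple I Y f) = f i"
proof (rule extensionalityI[of _ "unit_ball Y"])
  show "cstab_comp Y (cstab_proj I P i) (cstab_tuple I Y f) \<in> extensional (unit_ball Y)"
    by (simp add: cstab_comp_def compose_def)
  show "f i \<in> extensional (unit_ball Y)" using cstab_homD(1)[OF f[OF i]] by (simp add: PiE_iff)
  fix y assume y: "y \<in> unit_ball Y"
  have "f j y \<in> unit_ball (P j)" if "j \<in> I" for j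
    by (rule cstab_hom_in_ball[OF f[OF that] y])
  with y have "cstab_tuple I Y f y \<in> unit_ball (prod_cone I P)"
    by (auto simp: cstab_tuple_def prod_unit_ball_iff finite_I)
  with y i show "cstab_comp Y (cstab_proj I P i) (cstab_tuple I Y f) y = f i y"
    by (simp add: cstab_comp_eq cstab_proj_def) (simp add: cstab_tuple_def)
qed

text \<open>A point of the product is determined by its coordinates in \<open>I\<close>, and a
  morphism by its values on the ball; extensionality is used at both levels.\<close>

lemma tuple_unique:
  assumes h: "h \<in> cstab_hom Y (prod_cone I P)"
    and proj: "\<And>i. i \<in> I \<Longrightarrow> cstab_comp Y (cstab_proj I P i) h = f i"
  shows "h = cstab_tuple I Y f"
proof (rule extensionalityI[of _ "unit_ball Y"])
  show "h \<in> extensional (unit_ball Y)" using cstab_homD(1)[OF h] by (simp add: PiE_iff)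
  show "cstab_tuple I Y f \<in> extensional (unit_ball Y)" by (simp add: cstab_tuple_def)
  fix y assume y: "y \<in> unit_ball Y"
  have hy: "h y \<in> unit_ball (prod_cone I P)" by (rule cstab_hom_in_ball[OF h y])
  then have "h y \<in> extensional I" by (simp add: prod_unit_ball_iff finite_I PiE_iff)
  moreover have "h y i = f i y" if "i \<in> I" for i
    using fun_cong[OF proj[OF that], of y] y hy by (simp add: cstab_comp_eq cstab_proj_def)
  ultimately show "h y = cstab_tuple I Y f y"
    using y by (auto simp: cstab_tuple_def intro!: extensionalityI[of _ I])
qed

end

section \<open>The terminal object\<close>

lemma zero_measurable_complete_cone: "measurable_complete_cone zero_cone"
proof -
  have monoid: "abelian_monoid zero_cone"
    by (rule abelian_monoidI) (simp_all add: zero_cone_def)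
  have pos: "pos_cone zero_cone"
    by (intro pos_cone.intro monoid pos_cone_axioms.intro) (simp_all add: zero_cone_def)
  have le: "cone_le zero_cone x y" for x y by (simp add: cone_le_def zero_cone_def)
  then have lub: "cone_lub zero_cone x s" for x s by (simp add: cone_lub_def)
  have complete: "complete_cone zero_cone"
    by (intro complete_cone.intro pos complete_cone_axioms.intro bexI[of _ "()"] lub)
      (simp add: unit_ball_def zero_cone_def)
  have dual: "(\<lambda>x\<in>{()}. 0) \<in> dual_cone zero_cone"
    by (auto simp: dual_cone_def preserves_lubs_def cone_lub_def cone_le_def nonneg_real_cone_def)
      (auto simp: zero_cone_def)
  have "measurable_cone zero_cone"
  proof (intro measurable_cone.intro pos measurable_cone_axioms.intro)
    show "mtests zero_cone n \<subseteq> space (Rn n) \<rightarrow>\<^sub>E dual_cone zero_cone" for n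
      using dual by (auto simp: zero_cone_def)
    show "(\<lambda>r\<in>space (Rn n). \<lambda>x\<in>carrier zero_cone. 0) \<in> mtests zero_cone n" for n
      by (simp add: zero_cone_def)
    show "(\<lambda>r\<in>space (Rn p). l (h r)) \<in> mtests zero_cone p"
      if "l \<in> mtests zero_cone n" "h \<in> Rn p \<rightarrow>\<^sub>M Rn n" for l n h p
      using that measurable_space[OF that(2)] by (auto simp: zero_cone_def intro!: restrict_ext)
    show "(\<lambda>r. l r x) \<in> borel_measurable (Rn n)" if "l \<in> mtests zero_cone n" for l n x
      using that by (subst measurable_cong[where g = "\<lambda>_. 0"]) (auto simp: zero_cone_def)
  qed
  then show ?thesis using complete by (rule measurable_complete_cone.intro)
qed

text \<open>The ball of the target is a single point, so extensional functions into it are unique.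
  For existence, any two elements of the target are related and every test vanishes, which settles
  order, lubs and measurability at once.\<close>

lemma zero_cone_terminal: "\<exists>!h. h \<in> cstab_hom Y zero_cone"
proof (rule ex1I)
  have le: "cone_le zero_cone x y" for x y by (simp add: cone_le_def zero_cone_def)
  have ball: "unit_ball zero_cone = {()}" by (auto simp: unit_ball_def zero_cone_def)
  show "(\<lambda>x\<in>unit_ball Y. ()) \<in> cstab_hom Y zero_cone" (is "?h \<in> _")
  proof (rule cstab_homI)
    show "?h \<in> unit_ball Y \<rightarrow>\<^sub>E unit_ball zero_cone" by (simp add: ball)
    show "pre_stable Y zero_cone ?h" by (simp add: pre_stable_def le) (simp add: zero_cone_def)
    show "monotone_on (unit_ball Y) (cone_le Y) (cone_le zero_cone) ?h"
      by (simp add: monotone_on_def le)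
    show "preserves_lubs Y zero_cone ?h" by (simp add: preserves_lubs_def cone_lub_def le)
    have "(\<lambda>(r, s). l r ()) \<in> borel_measurable (Rn k \<Otimes>\<^sub>M Rn n)"
      if "l \<in> mtests zero_cone k" for k n l
      using that
      by (subst measurable_cong[where g = "\<lambda>_. 0"]) (auto simp: zero_cone_def space_pair_measure)
    then show "measurable_path zero_cone n (\<lambda>s. ?h (\<gamma> s))" for n \<gamma>
      by (auto simp: measurable_path_def) (auto simp: zero_cone_def)
  qed
  fix h assume "h \<in> cstab_hom Y zero_cone"
  from cstab_homD(1)[OF this] show "h = (\<lambda>x\<in>unit_ball Y. ())"
    by (intro extensionalityI[of _ "unit_ball Y"]) (auto simp: PiE_iff)
qed

theorem theorem6p3:
  fixes I :: "'i set" and P :: "'i \<Rightarrow> 'a mcone"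
  assumes "finite I"
    and "\<And>i. i \<in> I \<Longrightarrow> measurable_complete_cone (P i)"
  shows
    "(\<forall>A :: 'b mcone. measurable_complete_cone A \<longrightarrow> cstab_id A \<in> cstab_hom A A) \<and>
     (\<forall>(A :: 'b mcone) (B :: 'c mcone) (C :: 'd mcone).
        measurable_complete_cone A \<and> measurable_complete_cone B \<and> measurable_complete_cone C \<longrightarrow>
        (\<forall>f\<in>cstab_hom A B. \<forall>g\<in>cstab_hom B C. cstab_comp A g f \<in> cstab_hom A C)) \<and>
     (\<forall>(A :: 'b mcone) (B :: 'c mcone).
        measurable_complete_cone A \<and> measurable_complete_cone B \<longrightarrow>
        (\<forall>f\<in>cstab_hom A B. cstab_comp A f (cstab_id A) = f \<and> cstab_comp A (cstab_id B) f = f)) \<and>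
     (\<forall>(A :: 'b mcone) (B :: 'c mcone) (C :: 'd mcone) (D :: 'e mcone).
        measurable_complete_cone A \<and> measurable_complete_cone B \<and>
        measurable_complete_cone C \<and> measurable_complete_cone D \<longrightarrow>
        (\<forall>f\<in>cstab_hom A B. \<forall>g\<in>cstab_hom B C. \<forall>h\<in>cstab_hom C D.
           cstab_comp A h (cstab_comp A g f) = cstab_comp A (cstab_comp B h g) f)) \<and>
     measurable_complete_cone (prod_cone I P) \<and>
     (\<forall>i\<in>I. cstab_proj I P i \<in> cstab_hom (prod_cone I P) (P i)) \<and>
     (\<forall>(Y :: 'b mcone) (f :: 'i \<Rightarrow> 'b \<Rightarrow> 'a).
        measurable_complete_cone Y \<and> (\<forall>i\<in>I. f i \<in> cstab_hom Y (P i)) \<longrightarrow>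
        cstab_tuple I Y f \<in> cstab_hom Y (prod_cone I P) \<and>
        (\<forall>i\<in>I. cstab_comp Y (cstab_proj I P i) (cstab_tuple I Y f) = f i) \<and>
        (\<forall>h\<in>cstab_hom Y (prod_cone I P).
           (\<forall>i\<in>I. cstab_comp Y (cstab_proj I P i) h = f i) \<longrightarrow> h = cstab_tuple I Y f)) \<and>
     measurable_complete_cone zero_cone \<and>
     (\<forall>Y :: 'b mcone. measurable_complete_cone Y \<longrightarrow> (\<exists>!h. h \<in> cstab_hom Y zero_cone))"
proof -
  interpret mcone_family I P by (rule mcone_family.intro[OF assms])
  note pos = measurable_complete_cone_pos
  show ?thesis
  proof (intro conjI)
    show "\<forall>A :: 'b mcone. measurable_complete_cone A \<longrightarrow> cstab_id A \<in> cstab_hom A A"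
      by (blast intro: cstab_id_hom)
    show "\<forall>(A :: 'b mcone) (B :: 'c mcone) (C :: 'd mcone).
        measurable_complete_cone A \<and> measurable_complete_cone B \<and> measurable_complete_cone C \<longrightarrow>
        (\<forall>f\<in>cstab_hom A B. \<forall>g\<in>cstab_hom B C. cstab_comp A g f \<in> cstab_hom A C)"
      by (intro allI impI ballI, elim conjE) (rule cstab_comp_hom[OF pos pos pos])
    show "\<forall>i\<in>I. cstab_proj I P i \<in> cstab_hom (prod_cone I P) (P i)"
      by (blast intro: proj_hom)
    show "\<forall>(Y :: 'b mcone) (f :: 'i \<Rightarrow> 'b \<Rightarrow> 'a).
        measurable_complete_cone Y \<and> (\<forall>i\<in>I. f i \<in> cstab_hom Y (P i)) \<longrightarrow>
        cstab_tuple I Y f \<in> cstab_hom Y (prod_cone I P) \<and>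
        (\<forall>i\<in>I. cstab_comp Y (cstab_proj I P i) (cstab_tuple I Y f) = f i) \<and>
        (\<forall>h\<in>cstab_hom Y (prod_cone I P).
           (\<forall>i\<in>I. cstab_comp Y (cstab_proj I P i) h = f i) \<longrightarrow> h = cstab_tuple I Y f)"
    proof (intro allI impI, elim conjE, intro conjI ballI impI)
      fix Y :: "'b mcone" and f :: "'i \<Rightarrow> 'b \<Rightarrow> 'a"
      assume Y: "measurable_complete_cone Y" and f: "\<forall>i\<in>I. f i \<in> cstab_hom Y (P i)"
      show "cstab_tuple I Y f \<in> cstab_hom Y (prod_cone I P)"
        using f by (intro tuple_hom pos[OF Y]) auto
      show "cstab_comp Y (cstab_proj I P i) (cstab_tuple I Y f) = f i" if "i \<in> I" for i
        using f that by (intro proj_tuple) auto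
      show "h = cstab_tuple I Y f"
        if "h \<in> cstab_hom Y (prod_cone I P)" "\<forall>i\<in>I. cstab_comp Y (cstab_proj I P i) h = f i" for h
        using that by (intro tuple_unique) auto
    qed
  qed (simp_all add: cstab_comp_id cstab_comp_assoc prod_measurable_complete_cone
      zero_measurable_complete_cone zero_cone_terminal)
qed

end
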